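(* Let $R$ be a random compact set satisfying Assumption 1 of the context, let $\mathbf{R}_1,\mathbf{R}_2,\ldots$ be i.i.d. copies of it, and let $\sigma(Q,Q_0)=\rho(Q-Q_0)$ be a grid cost satisfying Assumption 2 of the context. Suppose the renewable production $Q_0=Q_{0,n}\in\mathbb{R}^d$ in the system with $n$ consumers satisfies $\lim_{n\to\infty}Q_{0,n}/n=q_0$ almost surely, for some $q_0\in\mathbb{R}^d$. Suppose furthermore that at any solution $$z^*\in\arg\max\{H(z)-z\cdot q_0: z\in\mathcal{P}\}$$ the function $h(\cdot;\mathbf{R}_i)$ is almost surely differentiable. Then, for any such $z^*$, $H$ is differentiable at $z^*$ and $$\rho\big(\nabla H(z^* )-q_0\big)=H(z^* )-z^*\cdot q_0 .$$ Furthermore, using prices $p^*=\lambda z^*$ with any $\lambda>0$ asymptotically solves the optimal demand response problem, i.e., almost surely $$\lim_{n\to\infty}\frac1n\,\sigma\Big(\sum_{i=1}^n q_i(p^* ),\,Q_{0,n}\Big)=\lim_{n\to\infty}\frac1n\,\widehat{\mathsf R}_n^{\mathsf{DM}},$$ where $$\widehat{\mathsf R}_n^{\mathsf{DM}}=\min\Big\{\sigma\Big(\sum_{i=1}^n q_i,\,Q_{0,n}\Big): q_i\in\mathbf{R}_i\text{ for all }i=1,\ldots,n\Big\}.$$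
   Context: $d\ge 1$ is the number of time periods; $\mathfrak{C}_d$ is the space of non-empty compact subsets of $\mathbb{R}^d$. For $C\subset\mathbb{R}^d$, $\|C\|=\sup\{\|c\|:c\in C\}$. Random sets. Given a probability space $(\Omega,\mathcal{F},P)$, a multifunction $R:\Omega\rightrightarrows\mathbb{R}^d$ with values in $\mathfrak{C}_d$ is measurable if $\{\omega: R(\omega)\cap O\ne\emptyset\}\in\mathcal{F}$ for all open $O\subset\mathbb{R}^d$; $\mathbf{R}=R(\omega)$ is then a random set. A selection of $\mathbf{R}$ is a random vector $X$ in $\mathbb{R}^d$ on $(\Omega,\mathcal F,P)$ with $P(X\in\mathbf{R})=1$ and $\mathbb{E}\|X\|<\infty$. The expectation is $\mathbb{E}[\mathbf{R}]=\{\mathbb{E}[X]: X \text{ is a selection of }\mathbf{R}\}$. Assumption 1. The consumers' indifference sets $\mathbf{R}_1,\mathbf{R}_2,\ldots$ are i.i.d. random elements of $\mathfrak{C}_d$, with the distribution of $\mathbf{R}=R(\omega)$ for a measurable multifunction $R$ with values in $\mathfrak{C}_d$ on a non-atomic probability space $(\Omega,\mathcal{F},P)$, and $\mathbb{E}[\|\mathbf{R}\|]<\infty$. (Then $\mathbb{E}[\mathbf{R}]\in\mathfrak{C}_d$; $\mathbb{E}[\mathbf{R}_i]$ means $\mathbb{E}[\mathbf{R}]$.) Assumption 2. $\sigma(Q,Q_0)=\rho(Q-Q_0)$, where $\rho:\mathbb{R}^d\to\mathbb{R}$ is convex and positively homogeneous of order one: $\rho(\alpha q)=\alpha\rho(q)$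 for all $\alpha\ge0$, $q\in\mathbb{R}^d$. Notation. $\mathcal{P}=\{z\in\mathbb{R}^d: z\cdot q\le\rho(q)\ \forall q\in\mathbb{R}^d\}$. For non-empty compact $C$, $h(p;C)=\min\{q\cdot p: q\in C\}$. $H(p)=h(p;\mathbb{E}[\mathbf{R}])$. Given a price $p\in\mathbb{R}^d$, consumer $i$ consumes some $q_i(p)\in\arg\min\{p\cdot q: q\in\mathbf{R}_i\}$. The optimal demand response problem is the minimization defining $\widehat{\mathsf R}_n^{\mathsf{DM}}$. *)

theory Defs
  imports "HOL-Probability.Probability"
begin

definition nonatomic :: "'w measure \<Rightarrow> bool" where
  "nonatomic M \<longleftrightarrow>
     (\<forall>A\<in>sets M. 0 < emeasure M A \<longrightarrow>
        (\<exists>B\<in>sets M. B \<subseteq> A \<and> 0 < emeasure M B \<and> emeasure M B < emeasure M A))"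

definition nonempty_compacts :: "'a::euclidean_space set set" where
  "nonempty_compacts = {K. compact K \<and> K \<noteq> {}}"

definition random_compact_set :: "'w measure \<Rightarrow> ('w \<Rightarrow> 'a::euclidean_space set) \<Rightarrow> bool" where
  "random_compact_set M R \<longleftrightarrow>
     (\<forall>\<omega>\<in>space M. R \<omega> \<in> nonempty_compacts) \<and>
     (\<forall>U. open U \<longrightarrow> {\<omega>\<in>space M. R \<omega> \<inter> U \<noteq> {}} \<in> sets M)"

text \<open>
  The hit sigma-algebra on the non-empty compact sets (the Borel sigma-algebra of the Hausdorff
  metric). Distributions and independence of random sets refer to it; by the lemma below, its
  measurable maps are exactly the random compact sets.
\<close>

definition hit_algebra :: "'a::euclidean_space set measure" where
  "hit_algebra =
     sigma nonempty_compacts {{K \<in> nonempty_compacts. K \<inter> U \<noteq> {}} |U. open U}"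

lemma space_hit_algebra: "space hit_algebra = nonempty_compacts"
  unfolding hit_algebra_def by (rule space_measure_of) auto

lemma random_compact_set_iff_measurable:
  fixes R :: "'w \<Rightarrow> 'a::euclidean_space set"
  shows "random_compact_set M R \<longleftrightarrow> R \<in> measurable M hit_algebra"
proof
  assume *: "random_compact_set M R"
  show "R \<in> measurable M hit_algebra"
    unfolding hit_algebra_def
  proof (rule measurable_measure_of)
    fix A :: "'a set set" assume "A \<in> {{K \<in> nonempty_compacts. K \<inter> U \<noteq> {}} |U. open U}"
    then obtain U where U: "open U" "A = {K \<in> nonempty_compacts. K \<inter> U \<noteq> {}}"
      by blast
    have "R -` A \<inter> space M = {\<omega>\<in>space M. R \<omega> \<inter> U \<noteq> {}}"
      using * U(2) by (auto simp: random_compact_set_def)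
    then show "R -` A \<inter> space M \<in> sets M"
      using * U(1) by (simp add: random_compact_set_def)
  qed (use * in \<open>auto simp: random_compact_set_def\<close>)
next
  assume *: "R \<in> measurable M hit_algebra"
  have sp: "R \<omega> \<in> nonempty_compacts" if "\<omega> \<in> space M" for \<omega>
    using measurable_space[OF * that] by (simp add: space_hit_algebra)
  have "{\<omega>\<in>space M. R \<omega> \<inter> U \<noteq> {}} \<in> sets M" if "open U" for U :: "'a set"
  proof -
    have "{K \<in> nonempty_compacts. K \<inter> U \<noteq> {}} \<in> sets hit_algebra"
      unfolding hit_algebra_def by (rule in_measure_of) (use that in auto)
    from measurable_sets[OF * this] show ?thesis
      using sp by (auto elim!: back_subst[where P = "\<lambda>A. A \<in> sets M"])
  qed
  with sp show "random_compact_set M R"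
    by (simp add: random_compact_set_def)
qed

definition set_norm :: "'a::euclidean_space set \<Rightarrow> real" where
  "set_norm C = (SUP c\<in>C. norm c)"

definition selection :: "'w measure \<Rightarrow> ('w \<Rightarrow> 'a::euclidean_space set) \<Rightarrow> ('w \<Rightarrow> 'a) \<Rightarrow> bool" where
  "selection M R X \<longleftrightarrow>
     X \<in> borel_measurable M \<and> (AE \<omega> in M. X \<omega> \<in> R \<omega>) \<and> integrable M (\<lambda>\<omega>. norm (X \<omega>))"

definition set_expectation :: "'w measure \<Rightarrow> ('w \<Rightarrow> 'a::euclidean_space set) \<Rightarrow> 'a set" where
  "set_expectation M R = {integral\<^sup>L M X |X. selection M R X}"

text \<open>
  Minima of real functions over infinite sets are written as infima. Over compact sets they are
  attained, which is recorded for both minima used here.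
\<close>

definition min_support :: "'a::euclidean_space \<Rightarrow> 'a set \<Rightarrow> real" where
  "min_support p C = (INF q\<in>C. q \<bullet> p)"

lemma min_support_attained:
  assumes "C \<in> nonempty_compacts"
  obtains q where "q \<in> C" "q \<bullet> p = min_support p C" "\<And>x. x \<in> C \<Longrightarrow> q \<bullet> p \<le> x \<bullet> p"
proof -
  have "continuous_on C (\<lambda>q. q \<bullet> p)" by (intro continuous_intros)
  then obtain q where q: "q \<in> C" "\<And>x. x \<in> C \<Longrightarrow> q \<bullet> p \<le> x \<bullet> p"
    using continuous_attains_inf[of C "\<lambda>q. q \<bullet> p"] assms by (auto simp: nonempty_compacts_def)
  then have "min_support p C = q \<bullet> p"
    unfolding min_support_def by (intro cInf_eq_minimum) auto
  with q that show thesis by simp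
qed

definition mean_support :: "'w measure \<Rightarrow> ('w \<Rightarrow> 'a::euclidean_space set) \<Rightarrow> 'a \<Rightarrow> real" where
  "mean_support M R p = min_support p (set_expectation M R)"

definition dual_set :: "('a::euclidean_space \<Rightarrow> real) \<Rightarrow> 'a set" where
  "dual_set \<rho> = {z. \<forall>q. z \<bullet> q \<le> \<rho> q}"

definition gradient :: "('a::euclidean_space \<Rightarrow> real) \<Rightarrow> 'a \<Rightarrow> 'a" where
  "gradient f x = (THE g. GDERIV f x :> g)"

lemma gradient_eq:
  assumes "GDERIV f x :> g"
  shows "gradient f x = g"
  unfolding gradient_def
proof (rule the_equality)
  fix g' assume "GDERIV f x :> g'"
  with assms have "(\<lambda>h. h \<bullet> g') = (\<lambda>h. h \<bullet> g)"
    unfolding gderiv_def by (rule has_derivative_unique[rotated])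
  then show "g' = g" by (metis inner_commute vector_eq_rdot)
qed (fact assms)

lemma differentiable_imp_gradient:
  fixes f :: "'a::euclidean_space \<Rightarrow> real"
  assumes "f differentiable (at x)"
  shows "GDERIV f x :> gradient f x"
proof -
  obtain D where D: "(f has_derivative D) (at x)"
    using assms by (auto simp: differentiable_def)
  interpret D: bounded_linear D by (rule has_derivative_bounded_linear[OF D])
  have "D = (\<lambda>h. h \<bullet> (\<Sum>b\<in>Basis. D b *\<^sub>R b))"
  proof
    fix h
    have "D h = D (\<Sum>b\<in>Basis. (h \<bullet> b) *\<^sub>R b)" by (simp add: euclidean_representation)
    then show "D h = h \<bullet> (\<Sum>b\<in>Basis. D b *\<^sub>R b)"
      by (simp add: D.sum D.scaleR inner_sum_right mult.commute)
  qed
  with D have "GDERIV f x :> (\<Sum>b\<in>Basis. D b *\<^sub>R b)" by (simp add: gderiv_def)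
  then show ?thesis by (simp add: gradient_eq)
qed

definition optimal_dr_cost ::
    "('a::euclidean_space \<Rightarrow> 'a \<Rightarrow> real) \<Rightarrow> (nat \<Rightarrow> 'a set) \<Rightarrow> nat \<Rightarrow> 'a \<Rightarrow> real" where
  "optimal_dr_cost \<sigma> K n Q\<^sub>0 =
     Inf {\<sigma> (\<Sum>i=1..n. q i) Q\<^sub>0 |q. \<forall>i\<in>{1..n}. q i \<in> K i}"

lemma compact_sum_selections:
  fixes K :: "nat \<Rightarrow> 'a::euclidean_space set"
  assumes "\<forall>i\<in>{1..n}. K i \<in> nonempty_compacts"
  shows "{\<Sum>i=1..n. q i |q. \<forall>i\<in>{1..n}. q i \<in> K i} \<in> nonempty_compacts"
  using assms
proof (induction n)
  case 0
  then show ?case by (simp add: nonempty_compacts_def)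
next
  case (Suc n)
  let ?S = "\<lambda>n. {\<Sum>i=1..n. q i |q. \<forall>i\<in>{1..n}. q i \<in> K i}"
  have "?S (Suc n) = {x + y |x y. x \<in> ?S n \<and> y \<in> K (Suc n)}"
  proof (intro equalityI subsetI)
    fix s assume "s \<in> ?S (Suc n)"
    then obtain q where "\<forall>i\<in>{1..Suc n}. q i \<in> K i" "s = (\<Sum>i=1..Suc n. q i)" by blast
    then have "s = (\<Sum>i=1..n. q i) + q (Suc n)" "\<forall>i\<in>{1..n}. q i \<in> K i" "q (Suc n) \<in> K (Suc n)"
      by auto
    then show "s \<in> {x + y |x y. x \<in> ?S n \<and> y \<in> K (Suc n)}" by blast
  next
    fix s assume "s \<in> {x + y |x y. x \<in> ?S n \<and> y \<in> K (Suc n)}"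
    then obtain q y where q: "\<forall>i\<in>{1..n}. q i \<in> K i" "y \<in> K (Suc n)" "s = (\<Sum>i=1..n. q i) + y"
      by blast
    let ?q = "q(Suc n := y)"
    have "(\<Sum>i=1..n. ?q i) = (\<Sum>i=1..n. q i)" by (rule sum.cong) auto
    then have "s = (\<Sum>i=1..Suc n. ?q i)" using q(3) by simp
    moreover have "\<forall>i\<in>{1..Suc n}. ?q i \<in> K i" using q(1,2) by (auto simp: le_Suc_eq)
    ultimately show "s \<in> ?S (Suc n)" by blast
  qed
  moreover have "?S n \<in> nonempty_compacts" using Suc by simp
  moreover have "K (Suc n) \<in> nonempty_compacts" using Suc.prems by simp
  ultimately show ?case
    using compact_sums[of "?S n" "K (Suc n)"] unfolding nonempty_compacts_def by auto
qed

lemma optimal_dr_cost_attained: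
  fixes K :: "nat \<Rightarrow> 'a::euclidean_space set"
  assumes "\<forall>i\<in>{1..n}. K i \<in> nonempty_compacts"
    and "continuous_on UNIV (\<lambda>Q. \<sigma> Q Q\<^sub>0)"
  obtains q where "\<forall>i\<in>{1..n}. q i \<in> K i"
    and "optimal_dr_cost \<sigma> K n Q\<^sub>0 = \<sigma> (\<Sum>i=1..n. q i) Q\<^sub>0"
proof -
  let ?S = "{\<Sum>i=1..n. q i |q. \<forall>i\<in>{1..n}. q i \<in> K i}"
  have "compact ?S" "?S \<noteq> {}"
    using compact_sum_selections[OF assms(1)] unfolding nonempty_compacts_def mem_Collect_eq by blast+
  moreover have "continuous_on ?S (\<lambda>Q. \<sigma> Q Q\<^sub>0)"
    using assms(2) by (rule continuous_on_subset) simp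
  ultimately obtain s where s: "s \<in> ?S" "\<forall>Q\<in>?S. \<sigma> s Q\<^sub>0 \<le> \<sigma> Q Q\<^sub>0"
    using continuous_attains_inf[of ?S "\<lambda>Q. \<sigma> Q Q\<^sub>0"] by blast
  then obtain q where q: "\<forall>i\<in>{1..n}. q i \<in> K i" "s = (\<Sum>i=1..n. q i)" by blast
  have "optimal_dr_cost \<sigma> K n Q\<^sub>0 = \<sigma> s Q\<^sub>0"
    unfolding optimal_dr_cost_def
    by (rule cInf_eq_minimum) (use q s(2) in blast)+
  with q that show thesis by simp
qed

end

theory Submission
  imports Defs
begin

text \<open>
  The price \<open>z\<close> solves a concave maximization problem that is dual to the demand response problem, and
  the theorem says that there is no duality gap per consumer in the limit.

  Minimization and expectation commute (\<open>mean_support_eq_integral\<close>), so \<open>H = mean_support M R\<close> is the mean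
  of the random functions \<open>p \<mapsto> min_support p (R \<omega>)\<close>. Where such a function is differentiable at \<open>z\<close>, the
  minimizer at this price is unique and it is the gradient. Differentiating under the integral sign
  gives \<open>\<nabla>H z = m\<close>, where \<open>m\<close> is the mean of the minimizers, and \<open>H z = z \<bullet> m\<close>.

  As \<open>z\<close> maximizes \<open>H y - y \<bullet> q\<^sub>0\<close> over the convex dual set of \<open>\<rho>\<close>, the first-order condition says that it
  also maximizes the linear function \<open>y \<bullet> (m - q\<^sub>0)\<close> there. The sublinear function \<open>\<rho>\<close> is the support
  function of its dual set (\<open>sublinear_eq_support\<close>), hence
  \<open>\<rho> (m - q\<^sub>0) = z \<bullet> (m - q\<^sub>0) = H z - z \<bullet> q\<^sub>0\<close>.

  The prices \<open>l *\<^sub>R z\<close> and \<open>z\<close> have the same minimizers. Almost surely these are unique for all consumers,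
  so they agree with a measurable selection and are independent and identically distributed. By the
  strong law of large numbers the average consumption tends to \<open>m\<close>, and the cost per consumer tends to
  \<open>\<rho> (m - q\<^sub>0)\<close> since \<open>\<rho>\<close> is continuous and homogeneous. No other choice of demands does better: \<open>\<rho>\<close>
  dominates the linear function given by \<open>z\<close>, which is smallest at the same minimizers
  (\<open>optimal_dr_cost_bounds\<close>). So the optimal cost per consumer lies between \<open>z \<bullet> (A n - Q\<^sub>0 n) / n\<close> and
  \<open>\<rho> (A n - Q\<^sub>0 n) / n\<close>, where \<open>A n\<close> is the total consumption, and both tend to the same limit.

  Two general ingredients are proved on the way: a measurable choice of minimizers over a random compact
  set (\<open>cheapest_selection\<close>), and the strong law of large numbers for independent identically distributed
  integrable vectors. The latter is obtained from the maximal ergodic inequality and Kolmogorov's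
  zero-one law.
\<close>

section \<open>Measurable selection of minimizers\<close>

lemma norm_le_set_norm:
  fixes K :: "'a::euclidean_space set"
  assumes "K \<in> nonempty_compacts" "x \<in> K"
  shows "norm x \<le> set_norm K"
proof -
  have "bdd_above (norm ` K)"
    using assms by (auto simp: nonempty_compacts_def dest!: compact_imp_bounded
        intro!: bdd_above_norm[THEN iffD2])
  then show ?thesis
    unfolding set_norm_def by (rule cSUP_upper2[OF _ assms(2)]) simp
qed

lemma min_support_le:
  fixes K :: "'a::euclidean_space set"
  assumes "K \<in> nonempty_compacts" "x \<in> K"
  shows "min_support p K \<le> x \<bullet> p"
  using min_support_attained[OF assms(1), of p] assms(2) by metis

text \<open>
  A minimizer for the price \<open>p'\<close> is feasible for \<open>p\<close>, and its norm is at most \<open>set_norm K\<close>. This bound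
  makes the difference quotients of \<open>min_support\<close> dominated by an integrable function.
\<close>

lemma min_support_lipschitz:
  fixes K :: "'a::euclidean_space set"
  assumes K: "K \<in> nonempty_compacts"
  shows "\<bar>min_support p K - min_support p' K\<bar> \<le> set_norm K * norm (p - p')"
proof -
  have *: "min_support p K - min_support p' K \<le> set_norm K * norm (p - p')" for p p' :: 'a
  proof -
    obtain x where x: "x \<in> K" "x \<bullet> p' = min_support p' K"
      using min_support_attained[OF K] by metis
    have "min_support p K - min_support p' K \<le> x \<bullet> (p - p')"
      using min_support_le[OF K x(1), of p] x(2) by (simp add: inner_diff_right)
    also have "\<dots> \<le> norm x * norm (p - p')" by (rule norm_cauchy_schwarz)
    also have "\<dots> \<le> set_norm K * norm (p - p')"
      by (intro mult_right_mono norm_le_set_norm[OF K x(1)]) simp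
    finally show ?thesis .
  qed
  show ?thesis
    using *[of p p'] *[of p' p] by (simp add: norm_minus_commute abs_le_iff)
qed

lemma hit_open_measurable:
  fixes R :: "'w \<Rightarrow> 'a::euclidean_space set"
  assumes "R \<in> measurable M hit_algebra" "open U"
  shows "{\<omega>\<in>space M. R \<omega> \<inter> U \<noteq> {}} \<in> sets M"
  using assms by (simp add: random_compact_set_def flip: random_compact_set_iff_measurable)

lemma random_compact_set_compact:
  fixes R :: "'w \<Rightarrow> 'a::euclidean_space set"
  assumes "R \<in> measurable M hit_algebra" "\<omega> \<in> space M"
  shows "R \<omega> \<in> nonempty_compacts"
  using measurable_space[OF assms] by (simp add: space_hit_algebra)

text \<open>
  A compact set meets the closed set \<open>F\<close> as soon as it meets every open neighbourhood of \<open>F\<close>: the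
  distance to \<open>F\<close> attains its infimum on the compact set. So the open hits, which generate the
  sigma-algebra, also determine the closed hits.
\<close>

lemma hit_closed_measurable:
  fixes R :: "'w \<Rightarrow> 'a::euclidean_space set"
  assumes R: "R \<in> measurable M hit_algebra" and F: "closed F"
  shows "{\<omega>\<in>space M. R \<omega> \<inter> F \<noteq> {}} \<in> sets M"
proof (cases "F = {}")
  case False
  define U where "U n = {x. infdist x F < 1 / real (Suc n)}" for n
  have U: "open (U n)" for n
    unfolding U_def by (intro open_Collect_less continuous_intros)
  have "R \<omega> \<inter> F \<noteq> {} \<longleftrightarrow> (\<forall>n. R \<omega> \<inter> U n \<noteq> {})" if "\<omega> \<in> space M" for \<omega>
  proof
    assume "R \<omega> \<inter> F \<noteq> {}"
    moreover have "F \<subseteq> U n" for n by (auto simp: U_def)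
    ultimately show "\<forall>n. R \<omega> \<inter> U n \<noteq> {}" by blast
  next
    assume *: "\<forall>n. R \<omega> \<inter> U n \<noteq> {}"
    have "compact (R \<omega>)" "R \<omega> \<noteq> {}"
      using random_compact_set_compact[OF R that] by (auto simp: nonempty_compacts_def)
    then obtain x where x: "x \<in> R \<omega>" "\<forall>y\<in>R \<omega>. infdist x F \<le> infdist y F"
      using continuous_attains_inf[of "R \<omega>" "\<lambda>x. infdist x F"]
        continuous_on_infdist[OF continuous_on_id, of "R \<omega>" F] by auto
    have "infdist x F \<le> 0"
    proof (rule ccontr)
      assume "\<not> infdist x F \<le> 0"
      then obtain n where "1 / real (Suc n) < infdist x F"
        using nat_approx_posE[of "infdist x F"] by auto
      moreover obtain y where "y \<in> R \<omega>" "infdist y F < 1 / real (Suc n)"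
        using * by (auto simp: U_def)
      ultimately show False using x(2) by fastforce
    qed
    then have "x \<in> F"
      using in_closed_iff_infdist_zero[OF F False] infdist_nonneg[of x F] by force
    then show "R \<omega> \<inter> F \<noteq> {}" using x(1) by blast
  qed
  then have "{\<omega>\<in>space M. R \<omega> \<inter> F \<noteq> {}} = {\<omega>\<in>space M. \<forall>n. R \<omega> \<inter> U n \<noteq> {}}"
    by blast
  also have "\<dots> \<in> sets M"
    by (intro sets.sets_Collect_countable_All hit_open_measurable R U)
  finally show ?thesis .
qed simp

lemma measurable_min_support:
  fixes R :: "'w \<Rightarrow> 'a::euclidean_space set"
  assumes R: "R \<in> measurable M hit_algebra"
  shows "(\<lambda>\<omega>. min_support p (R \<omega>)) \<in> borel_measurable M"
  unfolding borel_measurable_iff_less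
proof
  fix a :: real
  have "min_support p (R \<omega>) < a \<longleftrightarrow> R \<omega> \<inter> {x. x \<bullet> p < a} \<noteq> {}" if "\<omega> \<in> space M" for \<omega>
    using min_support_attained[OF random_compact_set_compact[OF R that], of p]
      min_support_le[OF random_compact_set_compact[OF R that], of _ p] 
    by (metis (mono_tags, lifting) disjoint_iff mem_Collect_eq order_le_less_trans)
  then have "{\<omega> \<in> space M. min_support p (R \<omega>) < a} =
      {\<omega> \<in> space M. R \<omega> \<inter> {x. x \<bullet> p < a} \<noteq> {}}" by blast
  also have "\<dots> \<in> sets M"
    by (intro hit_open_measurable[OF R] open_Collect_less continuous_intros)
  finally show "{\<omega> \<in> space M. min_support p (R \<omega>) < a} \<in> sets M" .
qed

lemma measurable_set_norm:
  fixes R :: "'w \<Rightarrow> 'a::euclidean_space set"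
  assumes R: "R \<in> measurable M hit_algebra"
  shows "(\<lambda>\<omega>. set_norm (R \<omega>)) \<in> borel_measurable M"
  unfolding borel_measurable_iff_greater
proof
  fix a :: real
  have "a < set_norm (R \<omega>) \<longleftrightarrow> R \<omega> \<inter> {x. a < norm x} \<noteq> {}" if "\<omega> \<in> space M" for \<omega>
  proof -
    note K = random_compact_set_compact[OF R that]
    have "bdd_above (norm ` R \<omega>)" 
      using norm_le_set_norm[OF K] by (intro bdd_aboveI) auto
    then show ?thesis
      using K unfolding set_norm_def 
      by (subst less_cSUP_iff) (auto simp: nonempty_compacts_def)
  qed
  then have "{\<omega> \<in> space M. a < set_norm (R \<omega>)} =
      {\<omega> \<in> space M. R \<omega> \<inter> {x. a < norm x} \<noteq> {}}" by blast
  also have "\<dots> \<in> sets M"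
    by (intro hit_open_measurable[OF R] open_Collect_less continuous_intros)
  finally show "{\<omega> \<in> space M. a < set_norm (R \<omega>)} \<in> sets M" .
qed

definition cheapest :: "'a::euclidean_space \<Rightarrow> 'a set \<Rightarrow> 'a set" where
  "cheapest p K = {x \<in> K. x \<bullet> p = min_support p K}"

lemma cheapest_compact:
  fixes K :: "'a::euclidean_space set"
  assumes K: "K \<in> nonempty_compacts"
  shows "cheapest p K \<in> nonempty_compacts"
proof -
  have "cheapest p K = K \<inter> {x. x \<bullet> p = min_support p K}" by (auto simp: cheapest_def)
  moreover have "closed {x. x \<bullet> p = min_support p K}"
    by (intro closed_Collect_eq continuous_intros)
  ultimately have "compact (cheapest p K)"
    using K by (simp add: nonempty_compacts_def compact_Int_closed)
  moreover have "cheapest p K \<noteq> {}"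
    using min_support_attained[OF K, of p] by (auto simp: cheapest_def)
  ultimately show ?thesis by (simp add: nonempty_compacts_def)
qed

text \<open>
  The face \<open>cheapest p K\<close> meets a closed set \<open>F\<close> iff the least cost over \<open>K \<inter> F\<close> does not exceed
  \<open>min_support p K\<close>. By compactness it is enough to test budgets \<open>t\<close> that are rational and larger
  than \<open>min_support p K\<close>, which turns the event into a countable intersection of closed hits. Open
  sets are countable unions of closed ones.
\<close>

lemma measurable_cheapest:
  fixes R :: "'w \<Rightarrow> 'a::euclidean_space set"
  assumes R: "R \<in> measurable M hit_algebra"
  shows "(\<lambda>\<omega>. cheapest p (R \<omega>)) \<in> measurable M hit_algebra"
proof -
  have closed_case: "{\<omega>\<in>space M. cheapest p (R \<omega>) \<inter> F \<noteq> {}} \<in> sets M" if F: "closed F" for F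
  proof -
    let ?G = "\<lambda>t. F \<inter> {x. x \<bullet> p \<le> t}"
    have G: "closed (?G t)" for t
      by (intro closed_Int F closed_Collect_le continuous_intros)
    have "cheapest p (R \<omega>) \<inter> F \<noteq> {} \<longleftrightarrow>
      (\<forall>t::rat. \<not> min_support p (R \<omega>) < of_rat t \<or> R \<omega> \<inter> ?G (of_rat t) \<noteq> {})"
      if "\<omega> \<in> space M" for \<omega>
    proof
      assume "cheapest p (R \<omega>) \<inter> F \<noteq> {}"
      then obtain x where "x \<in> R \<omega>" "x \<in> F" "x \<bullet> p = min_support p (R \<omega>)"
        by (auto simp: cheapest_def)
      then show "\<forall>t::rat. \<not> min_support p (R \<omega>) < of_rat t \<or> R \<omega> \<inter> ?G (of_rat t) \<noteq> {}"
        by force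
    next
      assume *: "\<forall>t::rat. \<not> min_support p (R \<omega>) < of_rat t \<or> R \<omega> \<inter> ?G (of_rat t) \<noteq> {}"
      note K = random_compact_set_compact[OF R that]
      obtain t0 :: rat where "min_support p (R \<omega>) < of_rat t0"
        using of_rat_dense[of "min_support p (R \<omega>)" "min_support p (R \<omega>) + 1"] by auto
      then have "R \<omega> \<inter> F \<noteq> {}" using * by blast
      moreover have "compact (R \<omega> \<inter> F)"
        using K F by (simp add: nonempty_compacts_def compact_Int_closed)
      moreover have "continuous_on (R \<omega> \<inter> F) (\<lambda>x. x \<bullet> p)" by (intro continuous_intros)
      ultimately obtain x where x: "x \<in> R \<omega>" "x \<in> F" "\<forall>y\<in>R \<omega> \<inter> F. x \<bullet> p \<le> y \<bullet> p"
        using continuous_attains_inf[of "R \<omega> \<inter> F" "\<lambda>x. x \<bullet> p"] by auto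
      have "x \<bullet> p \<le> min_support p (R \<omega>)"
      proof (rule ccontr)
        assume "\<not> x \<bullet> p \<le> min_support p (R \<omega>)"
        then obtain t :: rat where t: "min_support p (R \<omega>) < of_rat t" "of_rat t < x \<bullet> p"
          using of_rat_dense[of "min_support p (R \<omega>)" "x \<bullet> p"] by auto
        then obtain y where "y \<in> R \<omega> \<inter> F" "y \<bullet> p \<le> of_rat t" using * by blast
        then show False using t x(3) by force
      qed
      then have "x \<bullet> p = min_support p (R \<omega>)" using min_support_le[OF K x(1), of p] by simp
      then show "cheapest p (R \<omega>) \<inter> F \<noteq> {}" using x by (auto simp: cheapest_def)
    qed
    then have "{\<omega>\<in>space M. cheapest p (R \<omega>) \<inter> F \<noteq> {}} =
      {\<omega>\<in>space M. \<forall>t::rat. \<not> min_support p (R \<omega>) < of_rat t \<or> R \<omega> \<inter> ?G (of_rat t) \<noteq> {}}"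
      by blast
    also have "\<dots> \<in> sets M"
    proof (intro sets.sets_Collect_countable_All sets.sets_Collect_disj)
      have [measurable]: "(\<lambda>\<omega>. min_support p (R \<omega>)) \<in> borel_measurable M"
        by (rule measurable_min_support[OF R])
      show "{\<omega>\<in>space M. \<not> min_support p (R \<omega>) < of_rat t} \<in> sets M" for t by measurable
    qed (rule hit_closed_measurable[OF R G])
    finally show ?thesis .
  qed
  have "{\<omega>\<in>space M. cheapest p (R \<omega>) \<inter> U \<noteq> {}} \<in> sets M" if U: "open U" for U :: "'a set"
  proof -
    have "fsigma_in euclidean U"
      using U by (intro open_imp_fsigma_in metrizable_space_euclidean) simp
    then obtain C :: "nat \<Rightarrow> 'a set" where C: "\<And>n. closed (C n)" "\<Union> (range C) = U"
      unfolding fsigma_in_ascending by auto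
    then have "{\<omega>\<in>space M. cheapest p (R \<omega>) \<inter> U \<noteq> {}} =
        {\<omega>\<in>space M. \<exists>n. cheapest p (R \<omega>) \<inter> C n \<noteq> {}}" by blast
    also have "\<dots> \<in> sets M"
      by (intro sets.sets_Collect_countable_Ex closed_case C)
    finally show ?thesis .
  qed
  then show ?thesis
    using cheapest_compact[OF random_compact_set_compact[OF R]]
    by (simp add: random_compact_set_def flip: random_compact_set_iff_measurable)
qed

text \<open>
  A measurable choice of minimizers, by lexicographic minimization: among the minimizers for \<open>p\<close> keep
  those that minimize the inner product with each basis vector in turn. Each refinement is measurable
  by \<open>measurable_cheapest\<close>, and after the last one a single point is left, whose coordinates are
  values of \<open>min_support\<close>. The choice is a function on the space of compact sets, so that composing
  it with independent random sets gives independent random vectors.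
\<close>

lemma cheapest_selection:
  fixes p :: "'a::euclidean_space"
  obtains s where "s \<in> borel_measurable hit_algebra"
    and "\<And>K. K \<in> nonempty_compacts \<Longrightarrow> s K \<in> cheapest p K"
proof -
  have refine: "\<exists>f. f \<in> measurable hit_algebra hit_algebra \<and>
      (\<forall>K\<in>nonempty_compacts. f K \<subseteq> cheapest p K \<and> (\<forall>b\<in>B. \<forall>x\<in>f K. \<forall>y\<in>f K. x \<bullet> b = y \<bullet> b))"
    if "finite B" for B :: "'a set"
    using that
  proof induction
    case empty
    show ?case
      by (rule exI[of _ "cheapest p"]) (use measurable_cheapest[OF measurable_ident] in simp)
  next
    case (insert b B)
    then obtain f where f: "f \<in> measurable hit_algebra hit_algebra"
      "\<forall>K\<in>nonempty_compacts. f K \<subseteq> cheapest p K \<and> (\<forall>b\<in>B. \<forall>x\<in>f K. \<forall>y\<in>f K. x \<bullet> b = y \<bullet> b)"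
      by blast
    show ?case
    proof (intro exI conjI)
      show "(\<lambda>K. cheapest b (f K)) \<in> measurable hit_algebra hit_algebra"
        by (rule measurable_cheapest[OF f(1)])
      have "cheapest b C \<subseteq> C" for C by (auto simp: cheapest_def)
      moreover have "x \<bullet> b = y \<bullet> b" if "x \<in> cheapest b C" "y \<in> cheapest b C" for x y C
        using that by (simp add: cheapest_def)
      ultimately show "\<forall>K\<in>nonempty_compacts. cheapest b (f K) \<subseteq> cheapest p K \<and>
        (\<forall>b'\<in>insert b B. \<forall>x\<in>cheapest b (f K). \<forall>y\<in>cheapest b (f K). x \<bullet> b' = y \<bullet> b')"
        using f(2) by blast
    qed
  qed
  obtain f where f: "f \<in> measurable hit_algebra hit_algebra"
    "\<And>K. K \<in> nonempty_compacts \<Longrightarrow> f K \<subseteq> cheapest p K"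
    "\<And>K b x y. K \<in> nonempty_compacts \<Longrightarrow> b \<in> Basis \<Longrightarrow> x \<in> f K \<Longrightarrow> y \<in> f K \<Longrightarrow> x \<bullet> b = y \<bullet> b"
    using refine[OF finite_Basis] by blast
  define s where "s K = (\<Sum>b\<in>Basis. min_support b (f K) *\<^sub>R b)" for K
  have "s K \<in> cheapest p K" if K: "K \<in> nonempty_compacts" for K
  proof -
    have fK: "f K \<in> nonempty_compacts"
      using random_compact_set_compact[OF f(1), of K] K by (simp add: space_hit_algebra)
    then obtain x where x: "x \<in> f K" by (auto simp: nonempty_compacts_def)
    have "min_support b (f K) = x \<bullet> b" if "b \<in> Basis" for b
      using min_support_attained[OF fK, of b] f(3)[OF K that _ x] by metis
    then have "s K = (\<Sum>b\<in>Basis. (x \<bullet> b) *\<^sub>R b)" by (simp add: s_def)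
    then have "s K = x" by (simp add: euclidean_representation)
    then show ?thesis using x f(2)[OF K] by blast
  qed
  moreover have "s \<in> borel_measurable hit_algebra"
    unfolding s_def
    by (intro borel_measurable_sum borel_measurable_scaleR measurable_min_support[OF f(1)]) simp
  ultimately show thesis using that by blast
qed

section \<open>The mean of the support function and its gradient\<close>

lemma integrable_cheapest:
  fixes R :: "'w \<Rightarrow> 'a::euclidean_space set"
  assumes R: "R \<in> measurable M hit_algebra"
    and int: "integrable M (\<lambda>\<omega>. set_norm (R \<omega>))"
    and s: "s \<in> borel_measurable hit_algebra" "\<And>K. K \<in> nonempty_compacts \<Longrightarrow> s K \<in> cheapest p K"
  shows "integrable M (\<lambda>\<omega>. s (R \<omega>))"
proof (rule Bochner_Integration.integrable_bound[OF int])
  show "(\<lambda>\<omega>. s (R \<omega>)) \<in> borel_measurable M" using measurable_compose[OF R s(1)] .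
  have "norm (s (R \<omega>)) \<le> norm (set_norm (R \<omega>))" if "\<omega> \<in> space M" for \<omega>
  proof -
    note K = random_compact_set_compact[OF R that]
    have "s (R \<omega>) \<in> R \<omega>" using s(2)[OF K] by (simp add: cheapest_def)
    from norm_le_set_norm[OF K this] show ?thesis by simp
  qed
  then show "AE \<omega> in M. norm (s (R \<omega>)) \<le> norm (set_norm (R \<omega>))" by simp
qed

text \<open>
  Minimization commutes with the expectation: no selection can cost less than the pointwise minimum,
  and a measurable choice of minimizers is a selection that attains it.
\<close>

lemma mean_support_eq_integral:
  fixes R :: "'w \<Rightarrow> 'a::euclidean_space set"
  assumes R: "R \<in> measurable M hit_algebra"
    and int: "integrable M (\<lambda>\<omega>. set_norm (R \<omega>))"
  shows "integrable M (\<lambda>\<omega>. min_support p (R \<omega>))"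
    and "mean_support M R p = (\<integral>\<omega>. min_support p (R \<omega>) \<partial>M)"
proof -
  obtain s :: "'a set \<Rightarrow> 'a" where s: "s \<in> borel_measurable hit_algebra"
    "\<And>K. K \<in> nonempty_compacts \<Longrightarrow> s K \<in> cheapest p K"
    using cheapest_selection by blast
  note ints = integrable_cheapest[OF R int s]
  have eq: "s (R \<omega>) \<bullet> p = min_support p (R \<omega>)" "s (R \<omega>) \<in> R \<omega>" if "\<omega> \<in> space M" for \<omega>
    using s(2)[OF random_compact_set_compact[OF R that]] by (auto simp: cheapest_def)
  have "integrable M (\<lambda>\<omega>. s (R \<omega>) \<bullet> p)" using ints by simp
  then show intm: "integrable M (\<lambda>\<omega>. min_support p (R \<omega>))"
    by (rule Bochner_Integration.integrable_cong[OF refl, THEN iffD1, rotated]) (rule eq(1))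
  have "(\<integral>\<omega>. s (R \<omega>) \<partial>M) \<bullet> p = (\<integral>\<omega>. s (R \<omega>) \<bullet> p \<partial>M)" using ints by simp
  also have "\<dots> = (\<integral>\<omega>. min_support p (R \<omega>) \<partial>M)"
    by (rule Bochner_Integration.integral_cong) (simp_all add: eq)
  finally have s_val: "(\<integral>\<omega>. s (R \<omega>) \<partial>M) \<bullet> p = (\<integral>\<omega>. min_support p (R \<omega>) \<partial>M)" .
  have sel: "selection M R (\<lambda>\<omega>. s (R \<omega>))"
    unfolding selection_def using ints eq by auto
  have le: "(\<integral>\<omega>. min_support p (R \<omega>) \<partial>M) \<le> integral\<^sup>L M X \<bullet> p" if X: "selection M R X" for X
  proof -
    have intX: "integrable M X" 
      using X integrable_norm_cancel by (auto simp: selection_def)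
    have "(\<integral>\<omega>. min_support p (R \<omega>) \<partial>M) \<le> (\<integral>\<omega>. X \<omega> \<bullet> p \<partial>M)"
    proof (rule integral_mono_AE[OF intm])
      show "AE \<omega> in M. min_support p (R \<omega>) \<le> X \<omega> \<bullet> p"
        using X min_support_le[OF random_compact_set_compact[OF R]]
        unfolding selection_def by auto
    qed (use intX in simp)
    then show ?thesis using intX by simp
  qed
  show "mean_support M R p = (\<integral>\<omega>. min_support p (R \<omega>) \<partial>M)"
    unfolding mean_support_def min_support_def[of p "set_expectation M R"]
  proof (rule cInf_eq_minimum)
    show "(\<integral>\<omega>. min_support p (R \<omega>) \<partial>M) \<in> (\<lambda>q. q \<bullet> p) ` set_expectation M R"
      using sel s_val unfolding set_expectation_def by force
  qed (use le in \<open>auto simp: set_expectation_def\<close>)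
qed

text \<open>
  For a minimizer \<open>x\<close> at \<open>z\<close>, the function \<open>p \<mapsto> x \<bullet> p - min_support p K\<close> is non-negative and vanishes
  at \<open>z\<close>, so its derivative there is zero.
\<close>

lemma min_support_derivative:
  fixes K :: "'a::euclidean_space set"
  assumes K: "K \<in> nonempty_compacts"
    and diff: "(\<lambda>p. min_support p K) differentiable (at z)"
    and x: "x \<in> cheapest z K"
  shows "GDERIV (\<lambda>p. min_support p K) z :> x"
proof -
  obtain D where D: "((\<lambda>p. min_support p K) has_derivative D) (at z)"
    using diff by (auto simp: differentiable_def)
  have "((\<lambda>p. x \<bullet> p - min_support p K) has_derivative (\<lambda>h. x \<bullet> h - D h)) (at z)"
    by (intro derivative_intros D)
  moreover have "x \<bullet> z - min_support z K \<le> x \<bullet> p - min_support p K" for p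
    using x min_support_le[OF K, of x p] by (simp add: cheapest_def)
  ultimately have "(\<lambda>h. x \<bullet> h - D h) = (\<lambda>h. 0)"
    by (intro has_derivative_local_min) (auto intro: always_eventually)
  then have "D = (\<lambda>h. h \<bullet> x)" by (auto simp: fun_eq_iff inner_commute)
  then show ?thesis using D by (simp add: gderiv_def)
qed

lemma differentiable_imp_cheapest_unique:
  fixes K :: "'a::euclidean_space set"
  assumes "K \<in> nonempty_compacts" "(\<lambda>p. min_support p K) differentiable (at z)"
    and "x \<in> cheapest z K" "y \<in> cheapest z K"
  shows "x = y"
  using gradient_eq[OF min_support_derivative[OF assms(1,2,3)]]
    gradient_eq[OF min_support_derivative[OF assms(1,2,4)]] by simp

text \<open>
  Differentiation under the integral sign, by dominated convergence. A measurable choice of minimizers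
  serves as the pointwise gradient, which makes the measurability of the gradient automatic.
\<close>

lemma mean_min_support_derivative:
  fixes R :: "'w \<Rightarrow> 'a::euclidean_space set"
  assumes R: "R \<in> measurable M hit_algebra"
    and int: "integrable M (\<lambda>\<omega>. set_norm (R \<omega>))"
    and s: "s \<in> borel_measurable hit_algebra" "\<And>K. K \<in> nonempty_compacts \<Longrightarrow> s K \<in> cheapest z K"
    and diff: "AE \<omega> in M. (\<lambda>p. min_support p (R \<omega>)) differentiable (at z)"
  shows "GDERIV (\<lambda>p. \<integral>\<omega>. min_support p (R \<omega>) \<partial>M) z :> (\<integral>\<omega>. s (R \<omega>) \<partial>M)"
proof -
  let ?h = "\<lambda>p \<omega>. min_support p (R \<omega>)" and ?X = "\<lambda>\<omega>. s (R \<omega>)"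
  let ?m = "\<integral>\<omega>. ?X \<omega> \<partial>M"
  note intX = integrable_cheapest[OF R int s] and inth = mean_support_eq_integral(1)[OF R int]
  define err where "err p \<omega> = (?h p \<omega> - ?h z \<omega> - (p - z) \<bullet> ?X \<omega>) / norm (p - z)" for p \<omega>
  have interr: "integrable M (err p)" for p
    unfolding err_def using intX inth by (intro integrable_divide integrable_diff) auto
  have err_val: "(\<integral>\<omega>. err p \<omega> \<partial>M) =
     ((\<integral>\<omega>. ?h p \<omega> \<partial>M) - (\<integral>\<omega>. ?h z \<omega> \<partial>M) - (p - z) \<bullet> ?m) / norm (p - z)" for p
    unfolding err_def using intX inth by simp
  have bound: "norm (err p \<omega>) \<le> 2 * set_norm (R \<omega>)" if "\<omega> \<in> space M" "p \<noteq> z" for p \<omega>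
  proof -
    note K = random_compact_set_compact[OF R that(1)]
    have "\<bar>?h p \<omega> - ?h z \<omega>\<bar> \<le> set_norm (R \<omega>) * norm (p - z)"
      by (rule min_support_lipschitz[OF K])
    moreover have "\<bar>(p - z) \<bullet> ?X \<omega>\<bar> \<le> set_norm (R \<omega>) * norm (p - z)"
    proof -
      have "?X \<omega> \<in> R \<omega>" using s(2)[OF K] by (simp add: cheapest_def)
      then have "norm (p - z) * norm (?X \<omega>) \<le> norm (p - z) * set_norm (R \<omega>)"
        by (intro mult_left_mono norm_le_set_norm[OF K]) simp_all
      then show ?thesis
        using Cauchy_Schwarz_ineq2[of "p - z" "?X \<omega>"] by (simp add: mult.commute)
    qed
    ultimately have "\<bar>?h p \<omega> - ?h z \<omega> - (p - z) \<bullet> ?X \<omega>\<bar> \<le> 2 * set_norm (R \<omega>) * norm (p - z)"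
      by linarith
    then show ?thesis using that(2) by (simp add: err_def divide_le_eq)
  qed
  have "((\<lambda>p. \<integral>\<omega>. err p \<omega> \<partial>M) \<longlongrightarrow> 0) (at z)"
    unfolding tendsto_at_iff_sequentially comp_def
  proof (intro allI impI)
    fix Y :: "nat \<Rightarrow> 'a" assume Y: "\<forall>i. Y i \<in> UNIV - {z}" "Y \<longlonglongrightarrow> z"
    have "(\<lambda>i. \<integral>\<omega>. err (Y i) \<omega> \<partial>M) \<longlonglongrightarrow> (\<integral>\<omega>. 0 \<partial>M)"
    proof (rule integral_dominated_convergence)
      show "AE \<omega> in M. (\<lambda>i. err (Y i) \<omega>) \<longlonglongrightarrow> 0"
        using diff
      proof (rule AE_mp, intro AE_I2 impI)
        fix \<omega> assume \<omega>: "\<omega> \<in> space M" and d: "(\<lambda>p. ?h p \<omega>) differentiable (at z)"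
        note K = random_compact_set_compact[OF R \<omega>]
        have "((\<lambda>p. norm (?h p \<omega> - ?h z \<omega> - (p - z) \<bullet> ?X \<omega>) / norm (p - z)) \<longlongrightarrow> 0) (at z)"
          using min_support_derivative[OF K d s(2)[OF K]]
          unfolding gderiv_def has_derivative_iff_norm by simp
        then have "((\<lambda>p. norm (err p \<omega>)) \<longlongrightarrow> 0) (at z)" by (simp add: err_def)
        then have "((\<lambda>p. err p \<omega>) \<longlongrightarrow> 0) (at z)" by (rule tendsto_norm_zero_cancel)
        then show "(\<lambda>i. err (Y i) \<omega>) \<longlonglongrightarrow> 0"
          using Y unfolding tendsto_at_iff_sequentially comp_def by blast
      qed
      show "AE \<omega> in M. norm (err (Y i) \<omega>) \<le> 2 * set_norm (R \<omega>)" for i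
        using bound Y(1) by (intro AE_I2) auto
    qed (use interr int in auto)
    then show "(\<lambda>i. \<integral>\<omega>. err (Y i) \<omega> \<partial>M) \<longlonglongrightarrow> 0" by simp
  qed
  then have "((\<lambda>p. norm (\<integral>\<omega>. err p \<omega> \<partial>M)) \<longlongrightarrow> 0) (at z)" by (rule tendsto_norm_zero)
  then show ?thesis
    unfolding gderiv_def has_derivative_iff_norm err_val
    by (simp add: bounded_linear_inner_left)
qed

section \<open>The strong law of large numbers\<close>

lemma (in prob_space) indep_vars_reindex:
  assumes indep: "indep_vars M' X I" and f: "inj_on f J" "f ` J \<subseteq> I"
  shows "indep_vars (\<lambda>j. M' (f j)) (\<lambda>j. X (f j)) J"
proof -
  \<comment> \<open>Each variable is viewed as a block with the single index \<open>f j\<close>; distinct blocks are disjoint.\<close>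
  have "indep_vars (\<lambda>j. PiM {f j} M') (\<lambda>j \<omega>. restrict (\<lambda>i. X i \<omega>) {f j}) J"
    using f by (intro indep_vars_restrict[OF indep]) (auto simp: disjoint_family_on_def inj_on_def)
  from indep_vars_compose2[OF this, of "\<lambda>j x. x (f j)" "\<lambda>j. M' (f j)"]
  show ?thesis by simp
qed

text \<open>
  The maximum of the sums \<open>\<Sum>i<k. x i\<close> over \<open>k \<le> n\<close>. The recursion exhibits how it changes under
  a shift of the sequence, on which the maximal inequality rests.
\<close>

fun partial_sum_max :: "nat \<Rightarrow> (nat \<Rightarrow> real) \<Rightarrow> real" where
  "partial_sum_max 0 x = 0"
| "partial_sum_max (Suc n) x = max 0 (x 0 + partial_sum_max n (\<lambda>i. x (Suc i)))"

lemma partial_sum_max_nonneg: "0 \<le> partial_sum_max n x"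
  by (cases n) auto

lemma partial_sum_max_mono: "partial_sum_max n x \<le> partial_sum_max (Suc n) x"
proof (induction n arbitrary: x)
  case (Suc n)
  from Suc[of "\<lambda>i. x (Suc i)"] show ?case
    by (subst (1 2) partial_sum_max.simps) (intro max.mono add_left_mono order.refl)
qed simp

lemma partial_sum_max_le: "partial_sum_max n x \<le> (\<Sum>i<n. \<bar>x i\<bar>)"
proof (induction n arbitrary: x)
  case (Suc n)
  have "0 \<le> (\<Sum>i<n. \<bar>x (Suc i)\<bar>)" by (simp add: sum_nonneg)
  then show ?case
    using Suc[of "\<lambda>i. x (Suc i)"] by (simp add: sum.lessThan_Suc_shift del: sum.lessThan_Suc)
qed simp

lemma partial_sum_le_max: "k \<le> n \<Longrightarrow> (\<Sum>i<k. x i) \<le> partial_sum_max n x"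
proof (induction n arbitrary: x k)
  case (Suc n)
  show ?case
  proof (cases k)
    case (Suc k')
    then show ?thesis
      using Suc.IH[of k' "\<lambda>i. x (Suc i)"] Suc.prems
      by (simp add: sum.lessThan_Suc_shift max.coboundedI2 del: sum.lessThan_Suc)
  qed simp
qed simp

lemma measurable_partial_sum_max [measurable]:
  "partial_sum_max n \<in> borel_measurable (PiM UNIV (\<lambda>_. borel))"
proof (induction n)
  case 0
  then show ?case by (simp add: measurable_cong[of _ "partial_sum_max 0" "\<lambda>_. 0"])
next
  case (Suc n)
  have "(\<lambda>x i. x (Suc i)) \<in> measurable (PiM UNIV (\<lambda>_. borel)) (PiM UNIV (\<lambda>_. borel :: real measure))"
    by (rule measurable_PiM_single') auto
  from measurable_compose[OF this Suc]
  have "(\<lambda>x. max 0 (x 0 + partial_sum_max n (\<lambda>i. x (Suc i)))) \<in> borel_measurable (PiM UNIV (\<lambda>_. borel))"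
    by (intro borel_measurable_max borel_measurable_add borel_measurable_const
        measurable_component_singleton) auto
  then show ?case by (simp add: measurable_cong[of _ "partial_sum_max (Suc n)"])
qed

text \<open>
  Garsia's argument. Let \<open>V n\<close> be the maximum of the partial sums up to \<open>n\<close>, and \<open>V' n\<close> the same for
  the sequence without its first term. Where \<open>V (Suc n)\<close> is positive, the recursion says
  \<open>X 0 = V (Suc n) - V' n\<close>, which is at least \<open>V (Suc n) - V' (Suc n)\<close>; elsewhere that difference is at
  most zero. As \<open>V (Suc n)\<close> and \<open>V' (Suc n)\<close> have the same
  law, the mean of \<open>X 0\<close> over the event that \<open>V (Suc n)\<close> is positive is non-negative. These events
  increase to an event of full probability.
\<close>

lemma (in prob_space) maximal_ergodic_inequality:
  fixes X :: "nat \<Rightarrow> 'a \<Rightarrow> real"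
  assumes indep: "indep_vars (\<lambda>_. borel) X UNIV"
    and distr: "\<And>i. distr M borel (X i) = distr M borel (X 0)"
    and int: "integrable M (X 0)"
    and pos: "AE \<omega> in M. \<exists>n. 0 < (\<Sum>i<n. X i \<omega>)"
  shows "0 \<le> expectation (X 0)"
proof -
  have rv [measurable]: "random_variable borel (X i)" for i
    using indep by (simp add: indep_vars_def)
  have intX: "integrable M (X i)" for i
  proof -
    have "integrable (distr M borel (X i)) (\<lambda>x. x)"
      using int by (simp add: distr[of i] integrable_distr_eq)
    then show ?thesis by (simp add: integrable_distr_eq)
  qed
  have law: "distr M (PiM UNIV (\<lambda>_. borel)) (\<lambda>\<omega> i. X (f i) \<omega>) =
      PiM UNIV (\<lambda>_. distr M borel (X 0))" if "inj f" for f :: "nat \<Rightarrow> nat"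
  proof -
    have "indep_vars (\<lambda>_. borel) (\<lambda>i. X (f i)) UNIV"
      using indep_vars_reindex[OF indep that] by simp
    then have "distr M (PiM UNIV (\<lambda>_. borel)) (\<lambda>\<omega>. \<lambda>i\<in>UNIV. X (f i) \<omega>) =
        PiM UNIV (\<lambda>i. distr M borel (X (f i)))"
      by (subst (asm) indep_vars_iff_distr_eq_PiM) auto
    then show ?thesis by (simp add: distr[of "f _"] restrict_UNIV)
  qed
  define V where "V n \<omega> = partial_sum_max n (\<lambda>i. X i \<omega>)" for n \<omega>
  define V' where "V' n \<omega> = partial_sum_max n (\<lambda>i. X (Suc i) \<omega>)" for n \<omega>
  have meas [measurable]: "(\<lambda>\<omega> i. X (f i) \<omega>) \<in> measurable M (PiM UNIV (\<lambda>_. borel))" for f :: "nat \<Rightarrow> nat"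
    by (rule measurable_PiM_single') auto
  have [measurable]: "V n \<in> borel_measurable M" "V' n \<in> borel_measurable M" for n
    unfolding V_def V'_def by measurable
  have intV: "integrable M (V n)" "integrable M (V' n)" for n
  proof -
    show "integrable M (V n)"
      by (rule Bochner_Integration.integrable_bound[of _ "\<lambda>\<omega>. \<Sum>i<n. \<bar>X i \<omega>\<bar>"])
        (auto intro!: AE_I2 intX simp: V_def abs_of_nonneg partial_sum_max_nonneg partial_sum_max_le sum_nonneg)
    show "integrable M (V' n)"
      by (rule Bochner_Integration.integrable_bound[of _ "\<lambda>\<omega>. \<Sum>i<n. \<bar>X (Suc i) \<omega>\<bar>"])
        (auto intro!: AE_I2 intX simp: V'_def abs_of_nonneg partial_sum_max_nonneg partial_sum_max_le sum_nonneg)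
  qed
  have EV: "expectation (V n) = expectation (V' n)" for n
  proof -
    have "expectation (V n) = (\<integral>x. partial_sum_max n x \<partial>distr M (PiM UNIV (\<lambda>_. borel)) (\<lambda>\<omega> i. X i \<omega>))"
      unfolding V_def using meas[of "\<lambda>i. i"] by (subst integral_distr) auto
    also have "\<dots> = (\<integral>x. partial_sum_max n x \<partial>distr M (PiM UNIV (\<lambda>_. borel)) (\<lambda>\<omega> i. X (Suc i) \<omega>))"
      using law[of "\<lambda>i. i"] law[of Suc] by simp
    also have "\<dots> = expectation (V' n)"
      unfolding V'_def using meas[of Suc] by (subst integral_distr) auto
    finally show ?thesis .
  qed
  have step: "0 \<le> expectation (\<lambda>\<omega>. X 0 \<omega> * indicator {\<omega>. 0 < V (Suc n) \<omega>} \<omega>)" for n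
  proof -
    have "0 = expectation (\<lambda>\<omega>. V (Suc n) \<omega> - V' (Suc n) \<omega>)"
      using intV EV by simp
    also have "\<dots> \<le> expectation (\<lambda>\<omega>. X 0 \<omega> * indicator {\<omega>. 0 < V (Suc n) \<omega>} \<omega>)"
    proof (rule integral_mono)
      show "integrable M (\<lambda>\<omega>. X 0 \<omega> * indicator {\<omega>. 0 < V (Suc n) \<omega>} \<omega>)"
        by (rule Bochner_Integration.integrable_bound[OF intX[of 0]])
          (auto intro!: AE_I2 simp: indicator_def)
      fix \<omega>
      have "V' n \<omega> \<le> V' (Suc n) \<omega>" "0 \<le> V' (Suc n) \<omega>"
        unfolding V'_def by (rule partial_sum_max_mono partial_sum_max_nonneg)+
      moreover have "V (Suc n) \<omega> = max 0 (X 0 \<omega> + V' n \<omega>)" by (simp add: V_def V'_def)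
      ultimately show "V (Suc n) \<omega> - V' (Suc n) \<omega> \<le> X 0 \<omega> * indicator {\<omega>. 0 < V (Suc n) \<omega>} \<omega>"
        by (auto simp: indicator_def)
    qed (use intV in simp)
    finally show ?thesis .
  qed
  have "(\<lambda>n. expectation (\<lambda>\<omega>. X 0 \<omega> * indicator {\<omega>. 0 < V (Suc n) \<omega>} \<omega>)) \<longlonglongrightarrow> expectation (X 0)"
  proof (rule integral_dominated_convergence[where w = "\<lambda>\<omega>. \<bar>X 0 \<omega>\<bar>"])
    show "AE \<omega> in M. (\<lambda>n. X 0 \<omega> * indicator {\<omega>. 0 < V (Suc n) \<omega>} \<omega>) \<longlonglongrightarrow> X 0 \<omega>"
      using pos
    proof eventually_elim
      fix \<omega> assume "\<exists>n. 0 < (\<Sum>i<n. X i \<omega>)"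
      then obtain k where k: "0 < (\<Sum>i<k. X i \<omega>)" by blast
      have "0 < V (Suc n) \<omega>" if "n \<ge> k" for n
        using k partial_sum_le_max[of k "Suc n" "\<lambda>i. X i \<omega>"] that by (simp add: V_def)
      then have "\<forall>\<^sub>F n in sequentially. X 0 \<omega> * indicator {\<omega>. 0 < V (Suc n) \<omega>} \<omega> = X 0 \<omega>"
        by (intro eventually_sequentiallyI[of k]) simp
      then show "(\<lambda>n. X 0 \<omega> * indicator {\<omega>. 0 < V (Suc n) \<omega>} \<omega>) \<longlonglongrightarrow> X 0 \<omega>"
        by (rule tendsto_eventually)
    qed
  qed (auto intro!: AE_I2 intX simp: indicator_def)
  then show ?thesis using step by (intro LIMSEQ_le_const) auto
qed

text \<open>
  Unboundedness of the partial sums from above does not depend on finitely many terms, so by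
  Kolmogorov's zero-one law it has probability zero or one. If it had probability one, the maximal
  inequality would make the mean non-negative.
\<close>

lemma (in prob_space) partial_sums_bounded_above:
  fixes X :: "nat \<Rightarrow> 'a \<Rightarrow> real"
  assumes indep: "indep_vars (\<lambda>_. borel) X UNIV"
    and distr: "\<And>i. distr M borel (X i) = distr M borel (X 0)"
    and int: "integrable M (X 0)"
    and neg: "expectation (X 0) < 0"
  shows "AE \<omega> in M. \<exists>c. \<forall>n. (\<Sum>i<n. X i \<omega>) \<le> c"
proof -
  define F where "F i = {X i -` A \<inter> space M |A. A \<in> sets borel}" for i
  define U where "U = {\<omega>\<in>space M. \<forall>k::nat. \<exists>n. real k < (\<Sum>i<n. X i \<omega>)}"
  have rv [measurable]: "random_variable borel (X i)" for i
    using indep by (simp add: indep_vars_def)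
  have F: "F i \<subseteq> events" for i
    by (auto simp: F_def)
  \<comment> \<open>The sums that start at \<open>m\<close> differ from the full sums by a fixed amount, and they are measurable for
    the sigma-algebra \<open>T\<close> that the terms from \<open>m\<close> on generate.\<close>
  have "U \<in> sigma_sets (space M) (\<Union> (F ` {m..}))" for m
  proof -
    define T where "T = sigma (space M) (\<Union> (F ` {m..}))"
    have sub: "\<Union> (F ` {m..}) \<subseteq> Pow (space M)"
      using F sets.sets_into_space by blast
    have spT: "space T = space M" unfolding T_def using sub by (rule space_measure_of)
    have [measurable]: "X i \<in> borel_measurable T" if "i \<ge> m" for i
    proof (rule measurableI)
      fix A :: "real set" assume "A \<in> sets borel"
      then have "X i -` A \<inter> space M \<in> F i" by (auto simp: F_def)
      then show "X i -` A \<inter> space T \<in> sets T"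
        unfolding spT unfolding T_def sets_measure_of[OF sub] using that by (intro sigma_sets.Basic) auto
    qed simp
    have "U = {\<omega>\<in>space T. \<forall>k::nat. \<exists>n. real k < (\<Sum>i\<in>{m..<n}. X i \<omega>)}"
    proof -
      have "(\<forall>k::nat. \<exists>n. real k < (\<Sum>i<n. X i \<omega>)) \<longleftrightarrow>
          (\<forall>k::nat. \<exists>n. real k < (\<Sum>i\<in>{m..<n}. X i \<omega>))" for \<omega>
      proof -
        have split: "(\<Sum>i<n. X i \<omega>) = (\<Sum>i<m. X i \<omega>) + (\<Sum>i\<in>{m..<n}. X i \<omega>)" if "m \<le> n" for n
          using that by (simp add: lessThan_atLeast0 sum.atLeastLessThan_concat)
        show ?thesis
        proof (intro iffI allI)
          fix k :: nat assume *: "\<forall>k::nat. \<exists>n. real k < (\<Sum>i<n. X i \<omega>)"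
          obtain k' :: nat where k': "real k + (\<Sum>i<m. \<bar>X i \<omega>\<bar>) \<le> real k'"
            using real_arch_simple by blast
          obtain n where n: "real k' < (\<Sum>i<n. X i \<omega>)" using * by blast
          have abs: "\<bar>\<Sum>i<j. X i \<omega>\<bar> \<le> (\<Sum>i<m. \<bar>X i \<omega>\<bar>)" if "j \<le> m" for j
            by (rule order.trans[OF sum_abs sum_mono2]) (use that in auto)
          \<comment> \<open>The level \<open>k'\<close> is at least as large as each of the sums of at most \<open>m\<close> terms.\<close>
          have "m \<le> n"
          proof (rule ccontr)
            assume "\<not> m \<le> n"
            then show False using abs[of n] n k' by simp
          qed
          then show "\<exists>n. real k < (\<Sum>i\<in>{m..<n}. X i \<omega>)"
            using n k' split[of n] abs[of m] by (intro exI[of _ n]) (simp add: abs_le_iff)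
        next
          fix k :: nat assume *: "\<forall>k::nat. \<exists>n. real k < (\<Sum>i\<in>{m..<n}. X i \<omega>)"
          obtain k' :: nat where k': "real k - (\<Sum>i<m. X i \<omega>) \<le> real k'"
            using real_arch_simple by blast
          obtain n where n: "real k' < (\<Sum>i\<in>{m..<n}. X i \<omega>)" using * by blast
          have "m \<le> n" using n by (cases "m \<le> n") auto
          then show "\<exists>n. real k < (\<Sum>i<n. X i \<omega>)"
            using n k' split[of n] by (intro exI[of _ n]) simp
        qed
      qed
      then show ?thesis by (simp add: U_def spT)
    qed
    also have "\<dots> \<in> sets T" by measurable
    finally show ?thesis by (simp add: T_def sets_measure_of[OF sub])
  qed
  then have tail: "U \<in> tail_events F" by (simp add: tail_events_def)
  have "prob U = 0 \<or> prob U = 1"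
  proof (rule kolmogorov_0_1_law[OF _ _ tail])
    show "sigma_algebra (space M) (F i)" for i
    proof -
      have "F i = sets (vimage_algebra (space M) (X i) borel)"
        by (simp add: F_def sets_vimage_algebra2)
      then show ?thesis
        using sets.sigma_algebra_axioms[of "vimage_algebra (space M) (X i) borel"] by simp
    qed
    show "indep_sets F UNIV" using indep unfolding indep_vars_def2 F_def by simp
  qed
  moreover have Uev: "U \<in> events" unfolding U_def by measurable
  moreover have "prob U \<noteq> 1"
  proof
    assume "prob U = 1"
    then have "AE \<omega> in M. \<omega> \<in> U" using AE_in_set_eq_1[OF Uev] by simp
    then have "AE \<omega> in M. \<exists>n. 0 < (\<Sum>i<n. X i \<omega>)"
    proof (rule AE_mp, intro AE_I2 impI)
      fix \<omega> assume "\<omega> \<in> U"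
      then have "\<exists>n. real 0 < (\<Sum>i<n. X i \<omega>)" unfolding U_def by blast
      then show "\<exists>n. 0 < (\<Sum>i<n. X i \<omega>)" by simp
    qed
    from maximal_ergodic_inequality[OF indep distr int this] neg show False by simp
  qed
  ultimately have "AE \<omega> in M. \<omega> \<notin> U" using prob_eq_0[OF Uev] by simp
  then show ?thesis
    by (rule AE_mp) (auto simp: U_def not_less intro!: AE_I2)
qed

text \<open>
  The summands are centred at a point \<open>b\<close> strictly between the mean and \<open>a\<close>. The centred sums are bounded
  above, and dividing the bound by \<open>n\<close> makes it smaller than \<open>a - b\<close>.
\<close>

lemma (in prob_space) averages_eventually_le:
  fixes X :: "nat \<Rightarrow> 'a \<Rightarrow> real"
  assumes indep: "indep_vars (\<lambda>_. borel) X UNIV"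
    and distr: "\<And>i. distr M borel (X i) = distr M borel (X 0)"
    and int: "integrable M (X 0)"
    and a: "expectation (X 0) < a"
  shows "AE \<omega> in M. \<forall>\<^sub>F n in sequentially. (\<Sum>i<n. X i \<omega>) / real n < a"
proof -
  obtain b where b: "expectation (X 0) < b" "b < a" using dense[OF a] by blast
  have [measurable]: "random_variable borel (X i)" for i
    using indep by (simp add: indep_vars_def)
  have "AE \<omega> in M. \<exists>c. \<forall>n. (\<Sum>i<n. X i \<omega> - b) \<le> c"
  proof (rule partial_sums_bounded_above)
    show "indep_vars (\<lambda>_. borel) (\<lambda>i \<omega>. X i \<omega> - b) UNIV"
      by (rule indep_vars_compose2[OF indep]) simp
    show "distr M borel (\<lambda>\<omega>. X i \<omega> - b) = distr M borel (\<lambda>\<omega>. X 0 \<omega> - b)" for i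
    proof -
      have eq: "distr M borel (\<lambda>\<omega>. X j \<omega> - b) = distr (distr M borel (X j)) borel (\<lambda>x. x - b)" for j
        by (simp add: distr_distr comp_def)
      show ?thesis unfolding eq distr[of i] ..
    qed
  qed (use int b in \<open>auto simp: prob_space\<close>)
  then show ?thesis
  proof eventually_elim
    fix \<omega> assume "\<exists>c. \<forall>n. (\<Sum>i<n. X i \<omega> - b) \<le> c"
    then obtain c where c: "(\<Sum>i<n. X i \<omega>) \<le> c + real n * b" for n
      by (auto simp: sum_subtractf algebra_simps)
    have "(\<lambda>n. c / real n) \<longlonglongrightarrow> 0" by (rule lim_const_over_n)
    then have "\<forall>\<^sub>F n in sequentially. c / real n < a - b"
      using b(2) by (intro order_tendstoD(2)) auto
    then show "\<forall>\<^sub>F n in sequentially. (\<Sum>i<n. X i \<omega>) / real n < a"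
      using eventually_gt_at_top[of 0]
    proof eventually_elim
      case (elim n)
      have "(\<Sum>i<n. X i \<omega>) / real n \<le> (c + real n * b) / real n"
        by (intro divide_right_mono c) simp
      also have "\<dots> = c / real n + b" using elim by (simp add: add_divide_distrib)
      finally show ?case using elim by simp
    qed
  qed
qed

theorem (in prob_space) strong_law_of_large_numbers_real:
  fixes X :: "nat \<Rightarrow> 'a \<Rightarrow> real"
  assumes indep: "indep_vars (\<lambda>_. borel) X UNIV"
    and distr: "\<And>i. distr M borel (X i) = distr M borel (X 0)"
    and int: "integrable M (X 0)"
  shows "AE \<omega> in M. (\<lambda>n. (\<Sum>i<n. X i \<omega>) / real n) \<longlonglongrightarrow> expectation (X 0)"
proof -
  let ?m = "expectation (X 0)"
  have [measurable]: "random_variable borel (X i)" for i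
    using indep by (simp add: indep_vars_def)
  have upper: "AE \<omega> in M. \<forall>k::nat. \<forall>\<^sub>F n in sequentially. (\<Sum>i<n. X i \<omega>) / real n < ?m + 1 / real (Suc k)"
    unfolding AE_all_countable
    by (intro allI averages_eventually_le[OF indep distr int]) simp
  have "AE \<omega> in M. \<forall>k::nat. \<forall>\<^sub>F n in sequentially. (\<Sum>i<n. - X i \<omega>) / real n < - ?m + 1 / real (Suc k)"
    unfolding AE_all_countable
  proof (intro allI averages_eventually_le)
    show "indep_vars (\<lambda>_. borel) (\<lambda>i \<omega>. - X i \<omega>) UNIV"
      by (rule indep_vars_compose2[OF indep]) simp
    show "distr M borel (\<lambda>\<omega>. - X i \<omega>) = distr M borel (\<lambda>\<omega>. - X 0 \<omega>)" for i
    proof -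
      have eq: "distr M borel (\<lambda>\<omega>. - X j \<omega>) = distr (distr M borel (X j)) borel uminus" for j
        by (simp add: distr_distr comp_def)
      show ?thesis unfolding eq distr[of i] ..
    qed
  qed (use int in auto)
  with upper show ?thesis
  proof eventually_elim
    case (elim \<omega>)
    show ?case
    proof (rule LIMSEQ_I)
      fix r :: real assume "0 < r"
      then obtain k where k: "1 / real (Suc k) < r" using nat_approx_posE by blast
      have "\<forall>\<^sub>F n in sequentially. norm ((\<Sum>i<n. X i \<omega>) / real n - ?m) < r"
        using elim(1)[rule_format, of k] elim(2)[rule_format, of k]
        by eventually_elim (use k in \<open>auto simp: sum_negf abs_less_iff\<close>)
      then show "\<exists>n0. \<forall>n\<ge>n0. norm ((\<Sum>i<n. X i \<omega>) / real n - ?m) < r"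
        by (simp add: eventually_sequentially)
    qed
  qed
qed

theorem (in prob_space) strong_law_of_large_numbers:
  fixes X :: "nat \<Rightarrow> 'a \<Rightarrow> 'b::euclidean_space"
  assumes indep: "indep_vars (\<lambda>_. borel) X UNIV"
    and distr: "\<And>i. distr M borel (X i) = distr M borel (X 0)"
    and int: "integrable M (X 0)"
  shows "AE \<omega> in M. (\<lambda>n. (\<Sum>i<n. X i \<omega>) /\<^sub>R real n) \<longlonglongrightarrow> expectation (X 0)"
proof -
  have [measurable]: "random_variable borel (X i)" for i
    using indep by (simp add: indep_vars_def)
  have "AE \<omega> in M. \<forall>b\<in>Basis. (\<lambda>n. (\<Sum>i<n. X i \<omega> \<bullet> b) / real n) \<longlonglongrightarrow> expectation (\<lambda>\<omega>. X 0 \<omega> \<bullet> b)"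
  proof (intro AE_ball_countable[THEN iffD2] ballI strong_law_of_large_numbers_real)
    fix b :: 'b
    show "indep_vars (\<lambda>_. borel) (\<lambda>i \<omega>. X i \<omega> \<bullet> b) UNIV"
      by (rule indep_vars_compose2[OF indep]) simp
    show "distr M borel (\<lambda>\<omega>. X i \<omega> \<bullet> b) = distr M borel (\<lambda>\<omega>. X 0 \<omega> \<bullet> b)" for i
    proof -
      have eq: "distr M borel (\<lambda>\<omega>. X j \<omega> \<bullet> b) = distr (distr M borel (X j)) borel (\<lambda>x. x \<bullet> b)" for j
        by (simp add: distr_distr comp_def)
      show ?thesis unfolding eq distr[of i] ..
    qed
  qed (use int in \<open>auto intro: countable_finite\<close>)
  then show ?thesis
  proof eventually_elim
    case (elim \<omega>)
    show ?case
    proof (rule tendsto_componentwise_iff[THEN iffD2], rule ballI)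
      fix b :: 'b assume "b \<in> Basis"
      with elim have "(\<lambda>n. (\<Sum>i<n. X i \<omega> \<bullet> b) / real n) \<longlonglongrightarrow> expectation (\<lambda>\<omega>. X 0 \<omega> \<bullet> b)"
        by blast
      then show "(\<lambda>n. ((\<Sum>i<n. X i \<omega>) /\<^sub>R real n) \<bullet> b) \<longlonglongrightarrow> expectation (X 0) \<bullet> b"
        using int by (simp add: inner_sum_left divide_inverse_commute)
    qed
  qed
qed

section \<open>Duality for sublinear costs\<close>

text \<open>
  A sublinear function is the support function of its dual set, so a maximizer \<open>z\<close> of \<open>y \<mapsto> y \<bullet> v\<close> over
  the dual set attains \<open>\<rho> v\<close>. If \<open>z \<bullet> v\<close> were smaller, the point \<open>(v, z \<bullet> v)\<close> could be separated from
  the epigraph of \<open>\<rho>\<close>. The epigraph is a cone, so a linear functional that is bounded below on it is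
  non-negative there. Normalizing its last coordinate gives an element of the dual set that beats \<open>z\<close>.
\<close>

lemma sublinear_eq_support:
  fixes \<rho> :: "'a::euclidean_space \<Rightarrow> real"
  assumes conv: "convex_on UNIV \<rho>"
    and hom: "\<And>a x. 0 \<le> a \<Longrightarrow> \<rho> (a *\<^sub>R x) = a * \<rho> x"
    and z: "z \<in> dual_set \<rho>"
    and max: "\<And>y. y \<in> dual_set \<rho> \<Longrightarrow> y \<bullet> v \<le> z \<bullet> v"
  shows "\<rho> v = z \<bullet> v"
proof (rule antisym)
  show "z \<bullet> v \<le> \<rho> v" using z by (simp add: dual_set_def)
  show "\<rho> v \<le> z \<bullet> v"
  proof (rule ccontr)
    assume "\<not> \<rho> v \<le> z \<bullet> v"
    then have less: "z \<bullet> v < \<rho> v" by simp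
    define E where "E = {(x, t). \<rho> x \<le> t}"
    have cont: "continuous_on UNIV \<rho>" using conv by (intro convex_on_continuous) auto
    have "closed E"
      unfolding E_def case_prod_unfold
      by (intro closed_Collect_le continuous_intros continuous_on_compose2[OF cont]) auto
    moreover have "convex E"
      using conv convex_epigraph[of UNIV \<rho>] by (simp add: epigraph_def E_def case_prod_unfold)
    moreover have "(v, z \<bullet> v) \<notin> E" using less by (simp add: E_def)
    ultimately obtain w b where w: "w \<bullet> (v, z \<bullet> v) < b" "\<forall>e\<in>E. b < w \<bullet> e"
      using separating_hyperplane_closed_point[of E "(v, z \<bullet> v)"] by blast
    obtain y r where yr: "w = (y, r)" by (cases w)
    have at: "y \<bullet> v + r * (z \<bullet> v) < b" using w(1) by (simp add: yr)
    have above: "b < y \<bullet> x + r * t" if "\<rho> x \<le> t" for x t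
      using w(2) that by (auto simp: yr E_def)
    have \<rho>0: "\<rho> 0 = 0" using hom[of 0 0] by simp
    have "b < 0" using above[of 0 0] \<rho>0 by simp
    have nonneg: "0 \<le> y \<bullet> x + r * \<rho> x" for x
    proof (rule ccontr)
      define c where "c = y \<bullet> x + r * \<rho> x"
      assume "\<not> 0 \<le> y \<bullet> x + r * \<rho> x"
      then have c: "c < 0" by (simp add: c_def)
      \<comment> \<open>The factor \<open>b / c\<close> scales the value \<open>c\<close> of the functional to its strict lower bound \<open>b\<close>.\<close>
      have "b < y \<bullet> ((b / c) *\<^sub>R x) + r * \<rho> ((b / c) *\<^sub>R x)" by (rule above) simp
      also have "\<dots> = (b / c) * c"
        using c \<open>b < 0\<close> hom[of "b / c" x] by (simp add: c_def distrib_left divide_nonpos_neg)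
      finally show False using c by simp
    qed
    have "0 < r"
    proof -
      have "0 < r * (\<rho> v - z \<bullet> v)"
        using above[of v "\<rho> v"] at by (simp add: right_diff_distrib)
      then show ?thesis using less by (simp add: zero_less_mult_iff)
    qed
    have "((- (1 / r)) *\<^sub>R y) \<bullet> x \<le> \<rho> x" for x
    proof -
      have "- (y \<bullet> x) \<le> r * \<rho> x" using nonneg[of x] by simp
      then show ?thesis using \<open>0 < r\<close> by (simp add: field_simps)
    qed
    then have "(- (1 / r)) *\<^sub>R y \<in> dual_set \<rho>" by (simp add: dual_set_def)
    from max[OF this] have "- (y \<bullet> v) / r \<le> z \<bullet> v" by simp
    then have "0 \<le> y \<bullet> v + r * (z \<bullet> v)" using \<open>0 < r\<close> by (simp add: field_simps)
    then show False using at \<open>b < 0\<close> by simp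
  qed
qed

lemma convex_dual_set: "convex (dual_set \<rho>)"
proof -
  have "dual_set \<rho> = (\<Inter>q. {z. q \<bullet> z \<le> \<rho> q})" by (auto simp: dual_set_def inner_commute)
  then show ?thesis by (simp add: convex_INT convex_halfspace_le)
qed

text \<open>
  The first-order condition: along the segment from the maximizer \<open>z\<close> to \<open>y\<close> the objective
  \<open>x \<mapsto> f x - x \<bullet> c\<close> has a right derivative that is at most zero.
\<close>

lemma gradient_at_constrained_max:
  fixes f :: "'a::euclidean_space \<Rightarrow> real"
  assumes f: "GDERIV f z :> g" and P: "convex P" "z \<in> P" "y \<in> P"
    and max: "\<And>x. x \<in> P \<Longrightarrow> f x - x \<bullet> c \<le> f z - z \<bullet> c"
  shows "y \<bullet> (g - c) \<le> z \<bullet> (g - c)"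
proof -
  define \<gamma> where "\<gamma> t = z + t *\<^sub>R (y - z)" for t :: real
  have \<gamma>0: "\<gamma> 0 = z" by (simp add: \<gamma>_def)
  have "(\<gamma> has_derivative (\<lambda>t. t *\<^sub>R (y - z))) (at 0)"
    unfolding \<gamma>_def by (auto intro!: derivative_eq_intros)
  moreover have "((\<lambda>x. f x - x \<bullet> c) has_derivative (\<lambda>h. h \<bullet> g - h \<bullet> c)) (at (\<gamma> 0))"
    using f unfolding gderiv_def \<gamma>0 by (auto intro!: derivative_eq_intros)
  ultimately have "((\<lambda>t. f (\<gamma> t) - \<gamma> t \<bullet> c) has_derivative
      (\<lambda>t. (t *\<^sub>R (y - z)) \<bullet> g - (t *\<^sub>R (y - z)) \<bullet> c)) (at 0)"
    by (rule has_derivative_compose)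
  then have "((\<lambda>t. f (\<gamma> t) - \<gamma> t \<bullet> c) has_real_derivative (y - z) \<bullet> (g - c)) (at 0)"
    unfolding has_field_derivative_def
    by (rule back_subst[where P = "\<lambda>D. (_ has_derivative D) _"])
      (auto simp: fun_eq_iff inner_diff_right algebra_simps)
  then have "((\<lambda>t. (f (\<gamma> t) - \<gamma> t \<bullet> c - (f z - z \<bullet> c)) / t) \<longlongrightarrow> (y - z) \<bullet> (g - c)) (at_right 0)"
    unfolding has_field_derivative_iff \<gamma>0 by (auto intro: tendsto_within_subset)
  moreover have "\<forall>\<^sub>F t in at_right 0. (f (\<gamma> t) - \<gamma> t \<bullet> c - (f z - z \<bullet> c)) / t \<le> 0"
  proof -
    have "\<forall>\<^sub>F t in at_right (0::real). 0 < t \<and> t < 1"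
      unfolding eventually_at_right_field by (rule exI[of _ 1]) simp
    then show ?thesis
    proof eventually_elim
      case (elim t)
      have "\<gamma> t = (1 - t) *\<^sub>R z + t *\<^sub>R y" by (simp add: \<gamma>_def algebra_simps)
      then have "\<gamma> t \<in> P" using convexD[OF P(1) P(2,3), of "1 - t" t] elim by simp
      from max[OF this] show ?case using elim by (simp add: divide_nonpos_pos)
    qed
  qed
  ultimately have "(y - z) \<bullet> (g - c) \<le> 0"
    by (rule tendsto_upperbound) simp
  then show ?thesis by (simp add: inner_diff_left)
qed

text \<open>
  Weak duality: since \<open>\<rho>\<close> dominates the linear function given by \<open>z\<close>, every feasible demand profile costs
  at least what the individual minimizers for the price \<open>z\<close> achieve in this linear function.
\<close>

lemma optimal_dr_cost_bounds:
  fixes \<rho> :: "'a::euclidean_space \<Rightarrow> real"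
  assumes z: "z \<in> dual_set \<rho>"
    and K: "\<And>i. 1 \<le> i \<Longrightarrow> K i \<in> nonempty_compacts"
    and x: "\<And>i. 1 \<le> i \<Longrightarrow> x i \<in> K i"
  shows "(\<Sum>i=1..n. min_support z (K i)) - z \<bullet> Q \<le> optimal_dr_cost (\<lambda>Q Q'. \<rho> (Q - Q')) K n Q"
    and "optimal_dr_cost (\<lambda>Q Q'. \<rho> (Q - Q')) K n Q \<le> \<rho> ((\<Sum>i=1..n. x i) - Q)"
proof -
  let ?C = "{\<rho> ((\<Sum>i=1..n. q i) - Q) |q. \<forall>i\<in>{1..n}. q i \<in> K i}"
  have low: "(\<Sum>i=1..n. min_support z (K i)) - z \<bullet> Q \<le> c" if c: "c \<in> ?C" for c
  proof -
    obtain q where q: "\<forall>i\<in>{1..n}. q i \<in> K i" "c = \<rho> ((\<Sum>i=1..n. q i) - Q)"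
      using c by blast
    have "(\<Sum>i=1..n. min_support z (K i)) \<le> (\<Sum>i=1..n. q i \<bullet> z)"
      by (intro sum_mono min_support_le K q(1)[rule_format]) auto
    also have "\<dots> - z \<bullet> Q = z \<bullet> ((\<Sum>i=1..n. q i) - Q)"
      by (simp add: inner_sum_left inner_diff_right inner_commute[of z])
    also have "\<dots> \<le> c" using z by (simp add: dual_set_def q(2))
    finally show ?thesis by simp
  qed
  have mem: "\<rho> ((\<Sum>i=1..n. x i) - Q) \<in> ?C" using x by auto
  show "(\<Sum>i=1..n. min_support z (K i)) - z \<bullet> Q \<le> optimal_dr_cost (\<lambda>Q Q'. \<rho> (Q - Q')) K n Q"
    unfolding optimal_dr_cost_def using mem low by (intro cInf_greatest) auto
  show "optimal_dr_cost (\<lambda>Q Q'. \<rho> (Q - Q')) K n Q \<le> \<rho> ((\<Sum>i=1..n. x i) - Q)"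
    unfolding optimal_dr_cost_def by (rule cInf_lower[OF mem]) (use low in \<open>auto intro!: bdd_belowI\<close>)
qed

section \<open>Asymptotic optimality of the dual prices\<close>

lemma is_arg_min_price_cheapest:
  fixes K :: "'a::euclidean_space set"
  assumes K: "K \<in> nonempty_compacts" and l: "0 < l"
    and x: "is_arg_min (\<lambda>x. (l *\<^sub>R z) \<bullet> x) (\<lambda>x. x \<in> K) x"
  shows "x \<in> cheapest z K"
proof -
  have xK: "x \<in> K" and le: "x \<bullet> z \<le> y \<bullet> z" if "y \<in> K" for y
    using x l that by (auto simp: is_arg_min_def inner_commute not_less)
  obtain y where "y \<in> K" "y \<bullet> z = min_support z K"
    using min_support_attained[OF K] by metis
  then show ?thesis
    using le[of y] xK min_support_le[OF K, of x z] by (auto simp: cheapest_def)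
qed
theorem theorem4:
  fixes M :: "'w measure" and N :: "'v measure"
    and R :: "'w \<Rightarrow> (real ^ 'd) set"
    and Rs :: "nat \<Rightarrow> 'v \<Rightarrow> (real ^ 'd) set"
    and \<rho> :: "real ^ 'd \<Rightarrow> real"
    and \<sigma> :: "real ^ 'd \<Rightarrow> real ^ 'd \<Rightarrow> real"
    and Q\<^sub>0 :: "nat \<Rightarrow> 'v \<Rightarrow> real ^ 'd"
    and q\<^sub>0 :: "real ^ 'd"
    and q :: "nat \<Rightarrow> real ^ 'd \<Rightarrow> 'v \<Rightarrow> real ^ 'd"
  assumes "prob_space M" and "nonatomic M"
    and "random_compact_set M R"
    and "integrable M (\<lambda>\<omega>. set_norm (R \<omega>))"
    and "prob_space N"
    and "prob_space.indep_vars N (\<lambda>_. hit_algebra) Rs {1..}"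
    and "\<forall>i\<ge>1. distr N hit_algebra (Rs i) = distr M hit_algebra R"
    and "convex_on UNIV \<rho>"
    and "\<forall>\<alpha>\<ge>0. \<forall>x. \<rho> (\<alpha> *\<^sub>R x) = \<alpha> * \<rho> x"
    and "\<forall>Q Q'. \<sigma> Q Q' = \<rho> (Q - Q')"
    and "\<forall>n. Q\<^sub>0 n \<in> borel_measurable N"
    and "AE \<omega> in N. (\<lambda>n. Q\<^sub>0 n \<omega> /\<^sub>R real n) \<longlonglongrightarrow> q\<^sub>0"
    and "\<forall>z. is_arg_max (\<lambda>z. mean_support M R z - z \<bullet> q\<^sub>0) (\<lambda>z. z \<in> dual_set \<rho>) z \<longrightarrow>
          (\<forall>i\<ge>1. AE \<omega> in N. (\<lambda>p. min_support p (Rs i \<omega>)) differentiable (at z))"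
    and "\<forall>i\<ge>1. \<forall>p. \<forall>\<omega>\<in>space N. is_arg_min (\<lambda>x. p \<bullet> x) (\<lambda>x. x \<in> Rs i \<omega>) (q i p \<omega>)"
  shows "\<forall>z. is_arg_max (\<lambda>z. mean_support M R z - z \<bullet> q\<^sub>0) (\<lambda>z. z \<in> dual_set \<rho>) z \<longrightarrow>
           mean_support M R differentiable (at z) \<and>
           \<rho> (gradient (mean_support M R) z - q\<^sub>0) = mean_support M R z - z \<bullet> q\<^sub>0 \<and>
           (\<forall>l>0. AE \<omega> in N. \<exists>L.
              (\<lambda>n. \<sigma> (\<Sum>i=1..n. q i (l *\<^sub>R z) \<omega>) (Q\<^sub>0 n \<omega>) / real n) \<longlonglongrightarrow> L \<and>
              (\<lambda>n. optimal_dr_cost \<sigma> (\<lambda>i. Rs i \<omega>) n (Q\<^sub>0 n \<omega>) / real n) \<longlonglongrightarrow> L)"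
proof (intro allI impI)
  fix z assume argmax: "is_arg_max (\<lambda>z. mean_support M R z - z \<bullet> q\<^sub>0) (\<lambda>z. z \<in> dual_set \<rho>) z"
  interpret N: prob_space N by fact
  let ?H = "mean_support M R"
  have z: "z \<in> dual_set \<rho>"
    and zmax: "\<And>y. y \<in> dual_set \<rho> \<Longrightarrow> ?H y - y \<bullet> q\<^sub>0 \<le> ?H z - z \<bullet> q\<^sub>0"
    using argmax by (auto simp: is_arg_max_def not_less)
  have cont: "isCont \<rho> x" for x
    using convex_on_continuous[OF open_UNIV assms(8)] by (simp add: continuous_on_eq_continuous_at)
  have hom: "\<rho> (a *\<^sub>R x) = a * \<rho> x" if "0 \<le> a" for a x using assms(9) that by blast
  have \<sigma>: "\<sigma> = (\<lambda>Q Q'. \<rho> (Q - Q'))" using assms(10) by (simp add: fun_eq_iff)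
  have R: "R \<in> measurable M hit_algebra"
    using assms(3) by (simp add: random_compact_set_iff_measurable)
  have Rs: "Rs i \<in> measurable N hit_algebra" if "1 \<le> i" for i
    using assms(6) that by (simp add: N.indep_vars_def)
  have law: "distr N hit_algebra (Rs i) = distr M hit_algebra R" if "1 \<le> i" for i
    using assms(7) that by blast
  have Rs_compact: "Rs i \<omega> \<in> nonempty_compacts" if "1 \<le> i" "\<omega> \<in> space N" for i \<omega>
    by (rule random_compact_set_compact[OF Rs[OF that(1)] that(2)])
  have norm_meas: "set_norm \<in> borel_measurable (hit_algebra :: (real ^ 'd) set measure)"
    by (rule measurable_set_norm[OF measurable_ident_sets[OF refl]])
  have int: "integrable N (\<lambda>\<omega>. set_norm (Rs 1 \<omega>))"
    using assms(4) law[of 1] integrable_distr_eq[OF R norm_meas]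
      integrable_distr_eq[OF Rs norm_meas, of 1] by simp
  \<comment> \<open>The assumption of differentiability concerns the consumers on \<open>N\<close>, so \<open>?H\<close> is moved to \<open>N\<close> through
    the common law.\<close>
  have H: "?H = (\<lambda>p. \<integral>\<omega>. min_support p (Rs 1 \<omega>) \<partial>N)"
  proof
    fix p :: "real ^ 'd"
    have meas: "min_support p \<in> borel_measurable hit_algebra"
      by (rule measurable_min_support[OF measurable_ident_sets[OF refl]])
    have "?H p = (\<integral>\<omega>. min_support p (R \<omega>) \<partial>M)"
      by (rule mean_support_eq_integral(2)[OF R assms(4)])
    also have "\<dots> = integral\<^sup>L (distr N hit_algebra (Rs 1)) (min_support p)"
      using law[of 1] by (simp add: integral_distr[OF R meas])
    also have "\<dots> = (\<integral>\<omega>. min_support p (Rs 1 \<omega>) \<partial>N)"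
      by (rule integral_distr[OF Rs meas]) simp
    finally show "?H p = (\<integral>\<omega>. min_support p (Rs 1 \<omega>) \<partial>N)" .
  qed
  have diff: "AE \<omega> in N. (\<lambda>p. min_support p (Rs i \<omega>)) differentiable (at z)" if "1 \<le> i" for i
    using assms(13) argmax that by blast
  obtain s :: "(real ^ 'd) set \<Rightarrow> real ^ 'd" where s: "s \<in> borel_measurable hit_algebra"
    "\<And>K. K \<in> nonempty_compacts \<Longrightarrow> s K \<in> cheapest z K"
    using cheapest_selection[of z] by blast
  define m where "m = (\<integral>\<omega>. s (Rs 1 \<omega>) \<partial>N)"
  have ints: "integrable N (\<lambda>\<omega>. s (Rs 1 \<omega>))"
    by (rule integrable_cheapest[OF Rs int s]) simp_all
  have deriv: "GDERIV ?H z :> m"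
    unfolding H m_def by (rule mean_min_support_derivative[OF Rs int s diff]) simp_all
  have Hz: "?H z = z \<bullet> m"
  proof -
    have "z \<bullet> m = (\<integral>\<omega>. z \<bullet> s (Rs 1 \<omega>) \<partial>N)" using ints by (simp add: m_def)
    also have "\<dots> = ?H z"
      unfolding H using s(2)[OF Rs_compact[of 1]]
      by (intro Bochner_Integration.integral_cong) (auto simp: cheapest_def inner_commute)
    finally show ?thesis ..
  qed
  have attained: "\<rho> (m - q\<^sub>0) = z \<bullet> (m - q\<^sub>0)"
    using gradient_at_constrained_max[OF deriv convex_dual_set z _ zmax]
    by (intro sublinear_eq_support[OF assms(8) hom z]) auto
  have differentiable: "?H differentiable (at z)"
    using deriv by (auto simp: gderiv_def differentiable_def)
  moreover have "\<rho> (gradient ?H z - q\<^sub>0) = ?H z - z \<bullet> q\<^sub>0"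
    using gradient_eq[OF deriv] attained Hz by (simp add: inner_diff_right)
  moreover have "AE \<omega> in N. \<exists>L.
      (\<lambda>n. \<sigma> (\<Sum>i=1..n. q i (l *\<^sub>R z) \<omega>) (Q\<^sub>0 n \<omega>) / real n) \<longlonglongrightarrow> L \<and>
      (\<lambda>n. optimal_dr_cost \<sigma> (\<lambda>i. Rs i \<omega>) n (Q\<^sub>0 n \<omega>) / real n) \<longlonglongrightarrow> L"
    if l: "0 < l" for l
  proof -
    have lln: "AE \<omega> in N. (\<lambda>n. (\<Sum>i<n. s (Rs (Suc i) \<omega>)) /\<^sub>R real n) \<longlonglongrightarrow> m"
    proof -
      have "N.indep_vars (\<lambda>_. hit_algebra) (\<lambda>i. Rs (Suc i)) UNIV"
        using N.indep_vars_reindex[OF assms(6), of Suc UNIV] by auto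
      then have "N.indep_vars (\<lambda>_. borel) (\<lambda>i \<omega>. s (Rs (Suc i) \<omega>)) UNIV"
        by (rule N.indep_vars_compose2) (rule s(1))
      moreover have "distr N borel (\<lambda>\<omega>. s (Rs (Suc i) \<omega>)) = distr (distr M hit_algebra R) borel s" for i
        using distr_distr[OF s(1) Rs[of "Suc i"]] law[of "Suc i"] by (simp add: comp_def)
      ultimately show ?thesis
        using N.strong_law_of_large_numbers[of "\<lambda>i \<omega>. s (Rs (Suc i) \<omega>)"] ints by (simp add: m_def)
    qed
    have "AE \<omega> in N. \<forall>i. 1 \<le> i \<longrightarrow> (\<lambda>p. min_support p (Rs i \<omega>)) differentiable (at z)"
      using diff by (auto simp: AE_all_countable)
    with lln assms(12) AE_space show ?thesis
    proof eventually_elim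
      case (elim \<omega>)
      note K = Rs_compact[OF _ elim(3)]
      have cheapest: "q i (l *\<^sub>R z) \<omega> \<in> cheapest z (Rs i \<omega>)" if "1 \<le> i" for i
        by (rule is_arg_min_price_cheapest[OF K[OF that] l])
          (use assms(14) that elim(3) in blast)
      \<comment> \<open>The choices \<open>q i\<close> are arbitrary functions on \<open>N\<close>; uniqueness of the minimizer identifies them with
        the measurable selections to which the law of large numbers applies.\<close>
      have q_eq: "q i (l *\<^sub>R z) \<omega> = s (Rs i \<omega>)" if "1 \<le> i" for i
        using elim(4) that
        by (intro differentiable_imp_cheapest_unique[OF K _ cheapest s(2)[OF K]]) auto
      define A where "A n = (\<Sum>i=1..n. q i (l *\<^sub>R z) \<omega>)" for n
      have "A n = (\<Sum>i<n. s (Rs (Suc i) \<omega>))" for n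
        by (simp add: A_def sum.atLeast1_atMost_eq q_eq)
      then have A: "(\<lambda>n. A n /\<^sub>R real n) \<longlonglongrightarrow> m" using elim(1) by simp
      let ?d = "\<lambda>n. A n /\<^sub>R real n - Q\<^sub>0 n \<omega> /\<^sub>R real n"
      have d: "?d \<longlonglongrightarrow> m - q\<^sub>0" by (intro tendsto_diff A elim(2))
      \<comment> \<open>For \<open>n = 0\<close> both sides vanish, by \<open>inverse 0 = 0\<close> and homogeneity.\<close>
      have cost: "\<rho> (A n - Q\<^sub>0 n \<omega>) / real n = \<rho> (?d n)" for n
        using hom[of "inverse (real n)" "A n - Q\<^sub>0 n \<omega>"]
        by (simp add: scaleR_diff_right divide_inverse_commute)
      have lim: "(\<lambda>n. \<rho> (A n - Q\<^sub>0 n \<omega>) / real n) \<longlonglongrightarrow> \<rho> (m - q\<^sub>0)"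
        unfolding cost by (rule isCont_tendsto_compose[OF cont d])
      let ?opt = "\<lambda>n. optimal_dr_cost \<sigma> (\<lambda>i. Rs i \<omega>) n (Q\<^sub>0 n \<omega>)"
      have bounds: "z \<bullet> A n - z \<bullet> Q\<^sub>0 n \<omega> \<le> ?opt n" "?opt n \<le> \<rho> (A n - Q\<^sub>0 n \<omega>)" for n
      proof -
        have in_Rs: "q i (l *\<^sub>R z) \<omega> \<in> Rs i \<omega>" if "1 \<le> i" for i
          using cheapest[OF that] by (simp add: cheapest_def)
        have "(\<Sum>i=1..n. min_support z (Rs i \<omega>)) = z \<bullet> A n"
          using cheapest by (simp add: A_def inner_sum_right cheapest_def inner_commute)
        with optimal_dr_cost_bounds[of z \<rho> "\<lambda>i. Rs i \<omega>" "\<lambda>i. q i (l *\<^sub>R z) \<omega>" n "Q\<^sub>0 n \<omega>", OF z K in_Rs]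
        show "z \<bullet> A n - z \<bullet> Q\<^sub>0 n \<omega> \<le> ?opt n" "?opt n \<le> \<rho> (A n - Q\<^sub>0 n \<omega>)"
          by (simp_all add: \<sigma> A_def)
      qed
      have "(\<lambda>n. z \<bullet> ?d n) \<longlonglongrightarrow> \<rho> (m - q\<^sub>0)"
        unfolding attained by (intro tendsto_inner tendsto_const d)
      then have low: "(\<lambda>n. (z \<bullet> A n - z \<bullet> Q\<^sub>0 n \<omega>) / real n) \<longlonglongrightarrow> \<rho> (m - q\<^sub>0)"
        by (simp add: inner_diff_right divide_inverse_commute right_diff_distrib)
      have "(\<lambda>n. ?opt n / real n) \<longlonglongrightarrow> \<rho> (m - q\<^sub>0)"
        by (rule tendsto_sandwich[OF _ _ low lim]) (auto intro!: always_eventually divide_right_mono bounds)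
      with lim show ?case unfolding A_def by (auto simp: assms(10))
    qed
  qed
  ultimately show "?H differentiable (at z) \<and>
      \<rho> (gradient ?H z - q\<^sub>0) = ?H z - z \<bullet> q\<^sub>0 \<and>
      (\<forall>l>0. AE \<omega> in N. \<exists>L.
        (\<lambda>n. \<sigma> (\<Sum>i=1..n. q i (l *\<^sub>R z) \<omega>) (Q\<^sub>0 n \<omega>) / real n) \<longlonglongrightarrow> L \<and>
        (\<lambda>n. optimal_dr_cost \<sigma> (\<lambda>i. Rs i \<omega>) n (Q\<^sub>0 n \<omega>) / real n) \<longlonglongrightarrow> L)"
    by blast
qed

end
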